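(* Assume that Peano arithmetic (PA) is consistent and $\omega$-consistent. Let $\mathbf{R}(x)$ be a formula in the language of PA with exactly one free variable $x$ such that $$\vdash \mathbf{R}(x) \longleftrightarrow \exists z \Big(HetSeq(z) \land l(z)=Sx \land (\forall t \leq z) \big( Ele(t,z) \rightarrow Prov(\ulcorner \neg \mathbf{R}(\dot t) \urcorner) \big) \Big)$$ (such a formula exists by the generalized diagonal lemma). Then for every natural number $n$, the sentence $\mathbf{R}(\overline{n})$ is undecidable in PA.
   Context: PA is first-order Peano arithmetic in the language with constant symbol $0$, unary function symbol $S$ and binary function symbols $+,\times$. $\vdash\varphi$ means that $\varphi$ is provable in PA; $\varphi$ is refutable if $\vdash\neg\varphi$; a formula is undecidable if it is neither provable nor refutable. $\overline{n}$ is the numeral of $n$. PA is consistent if there is no formula $\varphi$ with both $\vdash\varphi$ and $\vdash\neg\varphi$. PA is $\omega$-consistent if there is no formula $\varphi(x)$ such that $\vdash\exists x\,\varphi(x)$ and $\vdash\neg\varphi(\overline{n})$ for every natural number $n$. $\ulcorner\varphi\urcorner$ is the Gödel number of $\varphi$ (or its numeral) under a fixed standard arithmetization of syntax. $Prov(x)$ is the standard $\Sigma_1$ provability predicate of PA ("there exists a code of a PA-proof of the formula with Gödel number $x$"). For a formula $\psi(x)$ with one free variable $x$, $Prov(\ulcorner\neg\psi(\dot t)\urcorner)$ denotes the formula with free variable $t$ stating that $Prov$ holds of the Gödel number of the negation of the sentence obtained from $\psi(x)$ by substituting the numeral of $t$ for $x$. Finite sequences of natural numbers are coded by natural numbers in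 a standard way in which every term of a sequence is at most its code; the following are $\Delta_0$: $Code(x)$ ("$x$ codes a finite sequence"), $l(x)$ (length of the sequence coded by $x$), $Dec(x,k)$ (the $k$-th term, $1\le k\le l(x)$, of the sequence coded by $x$), $HetSeq(x)$: $Code(x)$ and $Dec(x,y)\neq Dec(x,z)$ for all distinct positions $y,z\le l(x)$ (no two terms equal), and $Ele(x,y)$: $Code(y)$ and $Dec(y,u)=x$ for some position $u\le l(y)$ ($x$ is a term of the sequence coded by $y$). *)

theory Defs
  imports Main
begin

section \<open>Terms and formulas of arithmetic\<close>

text \<open>
  De Bruijn syntax: inside the scope of a quantifier, variable 0 is the bound one and the
  variables of the surroundings are shifted up by one.  Free variables are thus named by
  natural numbers.
\<close>

datatype tm =
    Var nat
  | Zero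
  | Succ tm
  | Add tm tm (infixl "\<^bold>+" 65)
  | Mul tm tm (infixl "\<^bold>*" 70)

datatype fm =
    Eq tm tm (infix "\<^bold>=" 50)
  | Neg fm ("\<^bold>\<not> _" [40] 40)
  | Imp fm fm (infixr "\<^bold>\<longrightarrow>" 25)
  | All fm ("\<^bold>\<forall>_" [40] 40)

definition And :: "fm \<Rightarrow> fm \<Rightarrow> fm" (infixr "\<^bold>\<and>" 35) where
  "(A \<^bold>\<and> B) = (\<^bold>\<not> (A \<^bold>\<longrightarrow> \<^bold>\<not> B))"

definition Or :: "fm \<Rightarrow> fm \<Rightarrow> fm" (infixr "\<^bold>\<or>" 30) where
  "(A \<^bold>\<or> B) = (\<^bold>\<not> A \<^bold>\<longrightarrow> B)"

definition Iff :: "fm \<Rightarrow> fm \<Rightarrow> fm" (infixr "\<^bold>\<longleftrightarrow>" 25) where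
  "(A \<^bold>\<longleftrightarrow> B) = ((A \<^bold>\<longrightarrow> B) \<^bold>\<and> (B \<^bold>\<longrightarrow> A))"

definition Ex :: "fm \<Rightarrow> fm" ("\<^bold>\<exists>_" [40] 40) where
  "(\<^bold>\<exists>A) = (\<^bold>\<not> (\<^bold>\<forall>(\<^bold>\<not> A)))"

primrec num :: "nat \<Rightarrow> tm" where
  "num 0 = Zero"
| "num (Suc n) = Succ (num n)"

primrec fv_tm :: "tm \<Rightarrow> nat set" where
  "fv_tm (Var i) = {i}"
| "fv_tm Zero = {}"
| "fv_tm (Succ t) = fv_tm t"
| "fv_tm (t \<^bold>+ u) = fv_tm t \<union> fv_tm u"
| "fv_tm (t \<^bold>* u) = fv_tm t \<union> fv_tm u"

primrec fv :: "fm \<Rightarrow> nat set" where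
  "fv (t \<^bold>= u) = fv_tm t \<union> fv_tm u"
| "fv (\<^bold>\<not> A) = fv A"
| "fv (A \<^bold>\<longrightarrow> B) = fv A \<union> fv B"
| "fv (\<^bold>\<forall>A) = {i. Suc i \<in> fv A}"

primrec lift_tm :: "nat \<Rightarrow> tm \<Rightarrow> tm" where
  "lift_tm c (Var i) = Var (if i < c then i else Suc i)"
| "lift_tm c Zero = Zero"
| "lift_tm c (Succ t) = Succ (lift_tm c t)"
| "lift_tm c (t \<^bold>+ u) = lift_tm c t \<^bold>+ lift_tm c u"
| "lift_tm c (t \<^bold>* u) = lift_tm c t \<^bold>* lift_tm c u"

primrec lift :: "nat \<Rightarrow> fm \<Rightarrow> fm" where
  "lift c (t \<^bold>= u) = (lift_tm c t \<^bold>= lift_tm c u)"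
| "lift c (\<^bold>\<not> A) = (\<^bold>\<not> lift c A)"
| "lift c (A \<^bold>\<longrightarrow> B) = (lift c A \<^bold>\<longrightarrow> lift c B)"
| "lift c (\<^bold>\<forall>A) = (\<^bold>\<forall>(lift (Suc c) A))"

text \<open>
  \<open>subst c w A\<close> replaces variable \<open>c\<close> by \<open>w\<close> and closes the gap by decrementing the variables
  above \<open>c\<close>.  If \<open>c\<close> is the only free variable of \<open>A\<close>, nothing is decremented, and
  \<open>subst c (num n) A\<close> is the sentence obtained from \<open>A\<close> by substituting the numeral of \<open>n\<close>.
\<close>

primrec subst_tm :: "nat \<Rightarrow> tm \<Rightarrow> tm \<Rightarrow> tm" where
  "subst_tm c w (Var i) = (if i < c then Var i else if i = c then w else Var (i - 1))"
| "subst_tm c w Zero = Zero"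
| "subst_tm c w (Succ t) = Succ (subst_tm c w t)"
| "subst_tm c w (t \<^bold>+ u) = subst_tm c w t \<^bold>+ subst_tm c w u"
| "subst_tm c w (t \<^bold>* u) = subst_tm c w t \<^bold>* subst_tm c w u"

primrec subst :: "nat \<Rightarrow> tm \<Rightarrow> fm \<Rightarrow> fm" where
  "subst c w (t \<^bold>= u) = (subst_tm c w t \<^bold>= subst_tm c w u)"
| "subst c w (\<^bold>\<not> A) = (\<^bold>\<not> subst c w A)"
| "subst c w (A \<^bold>\<longrightarrow> B) = (subst c w A \<^bold>\<longrightarrow> subst c w B)"
| "subst c w (\<^bold>\<forall>A) = (\<^bold>\<forall>(subst (Suc c) (lift_tm 0 w) A))"


section \<open>Peano arithmetic\<close>

definition basic_axioms :: "fm list" where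
  "basic_axioms =
    [\<^bold>\<forall>(Var 0 \<^bold>= Var 0),
     \<^bold>\<forall>\<^bold>\<forall>\<^bold>\<forall>(Var 2 \<^bold>= Var 1 \<^bold>\<longrightarrow> Var 2 \<^bold>= Var 0 \<^bold>\<longrightarrow> Var 1 \<^bold>= Var 0),
     \<^bold>\<forall>\<^bold>\<forall>(Var 1 \<^bold>= Var 0 \<^bold>\<longrightarrow> Succ (Var 1) \<^bold>= Succ (Var 0)),
     \<^bold>\<forall>\<^bold>\<forall>\<^bold>\<forall>\<^bold>\<forall>(Var 3 \<^bold>= Var 2 \<^bold>\<longrightarrow> Var 1 \<^bold>= Var 0 \<^bold>\<longrightarrow> Var 3 \<^bold>+ Var 1 \<^bold>= Var 2 \<^bold>+ Var 0),
     \<^bold>\<forall>\<^bold>\<forall>\<^bold>\<forall>\<^bold>\<forall>(Var 3 \<^bold>= Var 2 \<^bold>\<longrightarrow> Var 1 \<^bold>= Var 0 \<^bold>\<longrightarrow> Var 3 \<^bold>* Var 1 \<^bold>= Var 2 \<^bold>* Var 0),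
     \<^bold>\<forall>(\<^bold>\<not> Succ (Var 0) \<^bold>= Zero),
     \<^bold>\<forall>\<^bold>\<forall>(Succ (Var 1) \<^bold>= Succ (Var 0) \<^bold>\<longrightarrow> Var 1 \<^bold>= Var 0),
     \<^bold>\<forall>(Var 0 \<^bold>+ Zero \<^bold>= Var 0),
     \<^bold>\<forall>\<^bold>\<forall>(Var 1 \<^bold>+ Succ (Var 0) \<^bold>= Succ (Var 1 \<^bold>+ Var 0)),
     \<^bold>\<forall>(Var 0 \<^bold>* Zero \<^bold>= Zero),
     \<^bold>\<forall>\<^bold>\<forall>(Var 1 \<^bold>* Succ (Var 0) \<^bold>= Var 1 \<^bold>* Var 0 \<^bold>+ Var 1)]"

text \<open>
  In the induction schema, \<open>subst 0 (Succ (Var 0)) (lift 1 A)\<close> is \<open>A\<close> with variable 0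
  replaced by its successor and the other variables unchanged.
\<close>

inductive PA :: "fm \<Rightarrow> bool" ("\<turnstile> _" [20] 20) where
  basic: "A \<in> set basic_axioms \<Longrightarrow> \<turnstile> A"
| induction: "\<turnstile> subst 0 Zero A \<^bold>\<longrightarrow> \<^bold>\<forall>(A \<^bold>\<longrightarrow> subst 0 (Succ (Var 0)) (lift 1 A)) \<^bold>\<longrightarrow> \<^bold>\<forall>A"
| K: "\<turnstile> A \<^bold>\<longrightarrow> B \<^bold>\<longrightarrow> A"
| S: "\<turnstile> (A \<^bold>\<longrightarrow> B \<^bold>\<longrightarrow> C) \<^bold>\<longrightarrow> (A \<^bold>\<longrightarrow> B) \<^bold>\<longrightarrow> A \<^bold>\<longrightarrow> C"
| contra: "\<turnstile> (\<^bold>\<not> A \<^bold>\<longrightarrow> \<^bold>\<not> B) \<^bold>\<longrightarrow> B \<^bold>\<longrightarrow> A"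
| inst: "\<turnstile> \<^bold>\<forall>A \<^bold>\<longrightarrow> subst 0 w A"
| dist: "\<turnstile> \<^bold>\<forall>(A \<^bold>\<longrightarrow> B) \<^bold>\<longrightarrow> \<^bold>\<forall>A \<^bold>\<longrightarrow> \<^bold>\<forall>B"
| vacuous: "\<turnstile> A \<^bold>\<longrightarrow> \<^bold>\<forall>(lift 0 A)"
| MP: "\<turnstile> A \<^bold>\<longrightarrow> B \<Longrightarrow> \<turnstile> A \<Longrightarrow> \<turnstile> B"
| Gen: "\<turnstile> A \<Longrightarrow> \<turnstile> \<^bold>\<forall>A"

definition PA_consistent :: bool where
  "PA_consistent \<longleftrightarrow> \<not> (\<exists>A. (\<turnstile> A) \<and> (\<turnstile> \<^bold>\<not> A))"

definition PA_omega_consistent :: bool where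
  "PA_omega_consistent \<longleftrightarrow>
    \<not> (\<exists>A. fv A \<subseteq> {0} \<and> (\<turnstile> \<^bold>\<exists>A) \<and> (\<forall>n. \<turnstile> \<^bold>\<not> subst 0 (num n) A))"

definition undecidable :: "fm \<Rightarrow> bool" where
  "undecidable A \<longleftrightarrow> \<not> (\<turnstile> A) \<and> \<not> (\<turnstile> \<^bold>\<not> A)"


section \<open>Finite sequences\<close>

text \<open>
  The macros below take arbitrary terms as arguments; \<open>wk n t\<close> is \<open>t\<close> as seen from within the
  scope of \<open>n\<close> additional quantifiers.
\<close>

definition wk :: "nat \<Rightarrow> tm \<Rightarrow> tm" where
  "wk n = (lift_tm 0 ^^ n)"

definition Le :: "tm \<Rightarrow> tm \<Rightarrow> fm" (infix "\<^bold>\<le>" 50) where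
  "(t \<^bold>\<le> u) = (\<^bold>\<exists>(Var 0 \<^bold>+ wk 1 t \<^bold>= wk 1 u))"

definition Less :: "tm \<Rightarrow> tm \<Rightarrow> fm" (infix "\<^bold><" 50) where
  "(t \<^bold>< u) = (Succ t \<^bold>\<le> u)"

definition BAll :: "tm \<Rightarrow> fm \<Rightarrow> fm" ("\<^bold>\<forall>\<^bold>\<le>_./ _" [0, 10] 10) where
  "(\<^bold>\<forall>\<^bold>\<le>t. A) = (\<^bold>\<forall>(Var 0 \<^bold>\<le> wk 1 t \<^bold>\<longrightarrow> A))"

definition BEx :: "tm \<Rightarrow> fm \<Rightarrow> fm" ("\<^bold>\<exists>\<^bold>\<le>_./ _" [0, 10] 10) where
  "(\<^bold>\<exists>\<^bold>\<le>t. A) = (\<^bold>\<exists>(Var 0 \<^bold>\<le> wk 1 t \<^bold>\<and> A))"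

text \<open>The pairing function $(x + y)^2 + x$ is injective and bounds both components.\<close>

definition pair :: "nat \<Rightarrow> nat \<Rightarrow> nat" where
  "pair x y = (x + y) * (x + y) + x"

definition Pair_tm :: "tm \<Rightarrow> tm \<Rightarrow> tm" ("\<langle>_,/ _\<rangle>") where
  "\<langle>t, u\<rangle> = (t \<^bold>+ u) \<^bold>* (t \<^bold>+ u) \<^bold>+ t"

text \<open>
  The number $\langle l, \langle a, b \rangle\rangle$ codes the sequence of length $l$ whose $k$-th term
  ($1 \le k \le l$) is given by Goedel's beta function as the remainder of $a$ modulo $kb + 1$.
\<close>

definition Code_fm :: "tm \<Rightarrow> fm" where
  "Code_fm z = (\<^bold>\<exists>\<^bold>\<le>z. \<^bold>\<exists>\<^bold>\<le>wk 1 z. \<^bold>\<exists>\<^bold>\<le>wk 2 z. wk 3 z \<^bold>= \<langle>Var 2, \<langle>Var 1, Var 0\<rangle>\<rangle>)"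

text \<open>\<open>l(z) = n\<close>\<close>

definition Len_fm :: "tm \<Rightarrow> tm \<Rightarrow> fm" where
  "Len_fm z n = (\<^bold>\<exists>\<^bold>\<le>z. \<^bold>\<exists>\<^bold>\<le>wk 1 z. wk 2 z \<^bold>= \<langle>wk 2 n, \<langle>Var 1, Var 0\<rangle>\<rangle>)"

text \<open>\<open>1 \<le> k \<le> l(z)\<close> and \<open>Dec(z, k) = y\<close>\<close>

definition Dec_fm :: "tm \<Rightarrow> tm \<Rightarrow> tm \<Rightarrow> fm" where
  "Dec_fm z k y =
    (\<^bold>\<exists>\<^bold>\<le>z. \<^bold>\<exists>\<^bold>\<le>wk 1 z. \<^bold>\<exists>\<^bold>\<le>wk 2 z.
       wk 3 z \<^bold>= \<langle>Var 2, \<langle>Var 1, Var 0\<rangle>\<rangle> \<^bold>\<and>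
       num 1 \<^bold>\<le> wk 3 k \<^bold>\<and> wk 3 k \<^bold>\<le> Var 2 \<^bold>\<and>
       wk 3 y \<^bold>< Succ (wk 3 k \<^bold>* Var 0) \<^bold>\<and>
       (\<^bold>\<exists>\<^bold>\<le>Var 1. Var 2 \<^bold>= Var 0 \<^bold>* Succ (wk 4 k \<^bold>* Var 1) \<^bold>+ wk 4 y))"

definition HetSeq_fm :: "tm \<Rightarrow> fm" where
  "HetSeq_fm z =
    (Code_fm z \<^bold>\<and>
     (\<^bold>\<exists>\<^bold>\<le>z. Len_fm (wk 1 z) (Var 0) \<^bold>\<and>
       (\<^bold>\<forall>\<^bold>\<le>Var 0. \<^bold>\<forall>\<^bold>\<le>Var 1.
         (num 1 \<^bold>\<le> Var 1 \<^bold>\<and> num 1 \<^bold>\<le> Var 0 \<^bold>\<and> \<^bold>\<not> Var 1 \<^bold>= Var 0 \<^bold>\<longrightarrow>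
          \<^bold>\<not> (\<^bold>\<exists>\<^bold>\<le>wk 3 z. Dec_fm (wk 4 z) (Var 2) (Var 0) \<^bold>\<and> Dec_fm (wk 4 z) (Var 1) (Var 0))))))"

definition Ele_fm :: "tm \<Rightarrow> tm \<Rightarrow> fm" where
  "Ele_fm x y =
    (Code_fm y \<^bold>\<and>
     (\<^bold>\<exists>\<^bold>\<le>y. Len_fm (wk 1 y) (Var 0) \<^bold>\<and> (\<^bold>\<exists>\<^bold>\<le>Var 0. Dec_fm (wk 2 y) (Var 0) (wk 2 x))))"


section \<open>Arithmetized inductive definitions\<close>

definition Conjs :: "fm list \<Rightarrow> fm" where
  "Conjs As = foldr (\<^bold>\<and>) As (Zero \<^bold>= Zero)"

definition Disjs :: "fm list \<Rightarrow> fm" where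
  "Disjs As = foldr (\<^bold>\<or>) As (\<^bold>\<not> Zero \<^bold>= Zero)"

text \<open>
  A rule \<open>(n, ps, cs, u)\<close> has parameters \<open>Var 0, \<dots>, Var (n - 1)\<close>, premises \<open>ps\<close>, side conditions
  \<open>cs\<close> and conclusion \<open>u\<close>.  In \<open>Rule_fm\<close>, before the parameters are quantified, \<open>Var 0\<close> is the
  entry to be justified, \<open>Var 1\<close> its position, and \<open>Var 2\<close> the sequence in which it occurs; the
  premises must occur at earlier positions.
\<close>

type_synonym rule = "nat \<times> tm list \<times> fm list \<times> tm"

definition Earlier_fm :: "tm \<Rightarrow> tm \<Rightarrow> tm \<Rightarrow> fm" where
  "Earlier_fm s k x = (\<^bold>\<exists>\<^bold>\<le>k. Var 0 \<^bold>< wk 1 k \<^bold>\<and> Dec_fm (wk 1 s) (Var 0) (wk 1 x))"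

fun Rule_fm :: "rule \<Rightarrow> fm" where
  "Rule_fm (n, ps, cs, u) =
    (Ex ^^ n) (Conjs ([Var n \<^bold>= u] @ cs @ map (Earlier_fm (Var (n + 2)) (Var (n + 1))) ps))"

text \<open>
  \<open>Derivation_fm rs x\<close>: there is a sequence with last term \<open>x\<close>, each term of which follows from
  earlier terms by one of the rules \<open>rs\<close>.
\<close>

definition Derivation_fm :: "rule list \<Rightarrow> tm \<Rightarrow> fm" where
  "Derivation_fm rs x =
    (\<^bold>\<exists>((\<^bold>\<exists>\<^bold>\<le>Var 0. Len_fm (Var 1) (Var 0) \<^bold>\<and> Dec_fm (Var 1) (Var 0) (wk 2 x)) \<^bold>\<and>
      (\<^bold>\<forall>\<^bold>\<le>Var 0. \<^bold>\<forall>\<^bold>\<le>Var 1. (Dec_fm (Var 2) (Var 1) (Var 0) \<^bold>\<longrightarrow> Disjs (map Rule_fm rs)))))"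


section \<open>Goedel numbers and the arithmetization of syntax\<close>

primrec gn_tm :: "tm \<Rightarrow> nat" where
  "gn_tm (Var i) = pair 0 i"
| "gn_tm Zero = pair 1 0"
| "gn_tm (Succ t) = pair 2 (gn_tm t)"
| "gn_tm (t \<^bold>+ u) = pair 3 (pair (gn_tm t) (gn_tm u))"
| "gn_tm (t \<^bold>* u) = pair 4 (pair (gn_tm t) (gn_tm u))"

primrec gn :: "fm \<Rightarrow> nat" where
  "gn (t \<^bold>= u) = pair 5 (pair (gn_tm t) (gn_tm u))"
| "gn (\<^bold>\<not> A) = pair 6 (gn A)"
| "gn (A \<^bold>\<longrightarrow> B) = pair 7 (pair (gn A) (gn B))"
| "gn (\<^bold>\<forall>A) = pair 8 (gn A)"

definition gVar :: "tm \<Rightarrow> tm" where "gVar i = \<langle>num 0, i\<rangle>"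
definition gZero :: tm where "gZero = \<langle>num 1, num 0\<rangle>"
definition gSucc :: "tm \<Rightarrow> tm" where "gSucc t = \<langle>num 2, t\<rangle>"
definition gAdd :: "tm \<Rightarrow> tm \<Rightarrow> tm" where "gAdd t u = \<langle>num 3, \<langle>t, u\<rangle>\<rangle>"
definition gMul :: "tm \<Rightarrow> tm \<Rightarrow> tm" where "gMul t u = \<langle>num 4, \<langle>t, u\<rangle>\<rangle>"
definition gEq :: "tm \<Rightarrow> tm \<Rightarrow> tm" where "gEq t u = \<langle>num 5, \<langle>t, u\<rangle>\<rangle>"
definition gNeg :: "tm \<Rightarrow> tm" where "gNeg a = \<langle>num 6, a\<rangle>"
definition gImp :: "tm \<Rightarrow> tm \<Rightarrow> tm" where "gImp a b = \<langle>num 7, \<langle>a, b\<rangle>\<rangle>"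
definition gAll :: "tm \<Rightarrow> tm" where "gAll a = \<langle>num 8, a\<rangle>"

definition Term_fm :: "tm \<Rightarrow> fm" where
  "Term_fm = Derivation_fm
    [(1, [], [], gVar (Var 0)),
     (0, [], [], gZero),
     (1, [Var 0], [], gSucc (Var 0)),
     (2, [Var 0, Var 1], [], gAdd (Var 0) (Var 1)),
     (2, [Var 0, Var 1], [], gMul (Var 0) (Var 1))]"

definition Form_fm :: "tm \<Rightarrow> fm" where
  "Form_fm = Derivation_fm
    [(2, [], [Term_fm (Var 0), Term_fm (Var 1)], gEq (Var 0) (Var 1)),
     (1, [Var 0], [], gNeg (Var 0)),
     (2, [Var 0, Var 1], [], gImp (Var 0) (Var 1)),
     (1, [Var 0], [], gAll (Var 0))]"

text \<open>The graph of \<open>n \<mapsto> gn_tm (num n)\<close>.\<close>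

definition Num_fm :: "tm \<Rightarrow> tm \<Rightarrow> fm" where
  "Num_fm n t = Derivation_fm
    [(0, [], [], \<langle>Zero, gZero\<rangle>),
     (2, [\<langle>Var 0, Var 1\<rangle>], [], \<langle>Succ (Var 0), gSucc (Var 1)\<rangle>)]
    \<langle>n, t\<rangle>"

text \<open>The graphs of \<open>lift_tm\<close>, \<open>lift\<close>, \<open>subst_tm\<close> and \<open>subst\<close> on Goedel numbers.\<close>

definition Lift_tm_fm :: "tm \<Rightarrow> tm \<Rightarrow> tm \<Rightarrow> fm" where
  "Lift_tm_fm c t t' =
    (let j = (\<lambda>c t t'. \<langle>c, \<langle>t, t'\<rangle>\<rangle>); c0 = Var 0; i = Var 1;
         a = Var 1; a' = Var 2; b = Var 3; b' = Var 4 in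
     Derivation_fm
      [(2, [], [i \<^bold>< c0], j c0 (gVar i) (gVar i)),
       (2, [], [c0 \<^bold>\<le> i], j c0 (gVar i) (gVar (Succ i))),
       (1, [], [], j c0 gZero gZero),
       (3, [j c0 a a'], [], j c0 (gSucc a) (gSucc a')),
       (5, [j c0 a a', j c0 b b'], [], j c0 (gAdd a b) (gAdd a' b')),
       (5, [j c0 a a', j c0 b b'], [], j c0 (gMul a b) (gMul a' b'))]
      (j c t t'))"

definition Lift_fm :: "tm \<Rightarrow> tm \<Rightarrow> tm \<Rightarrow> fm" where
  "Lift_fm c x x' =
    (let j = (\<lambda>c x x'. \<langle>c, \<langle>x, x'\<rangle>\<rangle>); c0 = Var 0;
         a = Var 1; a' = Var 2; b = Var 3; b' = Var 4 in
     Derivation_fm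
      [(5, [], [Lift_tm_fm c0 a a', Lift_tm_fm c0 b b'], j c0 (gEq a b) (gEq a' b')),
       (3, [j c0 a a'], [], j c0 (gNeg a) (gNeg a')),
       (5, [j c0 a a', j c0 b b'], [], j c0 (gImp a b) (gImp a' b')),
       (3, [j (Succ c0) a a'], [], j c0 (gAll a) (gAll a'))]
      (j c x x'))"

definition Subst_tm_fm :: "tm \<Rightarrow> tm \<Rightarrow> tm \<Rightarrow> tm \<Rightarrow> fm" where
  "Subst_tm_fm c w t t' =
    (let j = (\<lambda>c w t t'. \<langle>c, \<langle>w, \<langle>t, t'\<rangle>\<rangle>\<rangle>); c0 = Var 0; w0 = Var 1; i = Var 2;
         a = Var 2; a' = Var 3; b = Var 4; b' = Var 5 in
     Derivation_fm
      [(3, [], [i \<^bold>< c0], j c0 w0 (gVar i) (gVar i)),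
       (2, [], [], j c0 w0 (gVar c0) w0),
       (3, [], [c0 \<^bold>\<le> i], j c0 w0 (gVar (Succ i)) (gVar i)),
       (2, [], [], j c0 w0 gZero gZero),
       (4, [j c0 w0 a a'], [], j c0 w0 (gSucc a) (gSucc a')),
       (6, [j c0 w0 a a', j c0 w0 b b'], [], j c0 w0 (gAdd a b) (gAdd a' b')),
       (6, [j c0 w0 a a', j c0 w0 b b'], [], j c0 w0 (gMul a b) (gMul a' b'))]
      (j c w t t'))"

definition Subst_fm :: "tm \<Rightarrow> tm \<Rightarrow> tm \<Rightarrow> tm \<Rightarrow> fm" where
  "Subst_fm c w x x' =
    (let j = (\<lambda>c w x x'. \<langle>c, \<langle>w, \<langle>x, x'\<rangle>\<rangle>\<rangle>); c0 = Var 0; w0 = Var 1;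
         a = Var 2; a' = Var 3; b = Var 4; b' = Var 5; w1 = Var 4 in
     Derivation_fm
      [(6, [], [Subst_tm_fm c0 w0 a a', Subst_tm_fm c0 w0 b b'],
         j c0 w0 (gEq a b) (gEq a' b')),
       (4, [j c0 w0 a a'], [], j c0 w0 (gNeg a) (gNeg a')),
       (6, [j c0 w0 a a', j c0 w0 b b'], [], j c0 w0 (gImp a b) (gImp a' b')),
       (5, [j (Succ c0) w1 a a'], [Lift_tm_fm Zero w0 w1], j c0 w0 (gAll a) (gAll a'))]
      (j c w x x'))"


section \<open>The provability predicate\<close>

text \<open>
  The rules follow the clauses of \<^const>\<open>PA\<close> one by one; a derivation by them is a (coded) proof
  in Peano arithmetic.  All unbounded quantifiers are existential and occur positively, in part
  within the scope of bounded universal ones, so \<open>Prov_fm\<close> is $\Sigma_1$ up to provable equivalence.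
\<close>

definition Prov_fm :: "tm \<Rightarrow> fm" where
  "Prov_fm =
    (let a = Var 0; b = Var 1; c = Var 2; w = Var 1; a0 = Var 1; a1 = Var 2; a2 = Var 3 in
     Derivation_fm
      (map (\<lambda>A. (0, [], [], num (gn A))) basic_axioms @
       [(4, [], [Form_fm a, Subst_fm Zero gZero a a0, Lift_fm (num 1) a a1,
                 Subst_fm Zero (num (gn_tm (Succ (Var 0)))) a1 a2],
          gImp a0 (gImp (gAll (gImp a a2)) (gAll a))),
        (2, [], [Form_fm a, Form_fm b], gImp a (gImp b a)),
        (3, [], [Form_fm a, Form_fm b, Form_fm c],
          gImp (gImp a (gImp b c)) (gImp (gImp a b) (gImp a c))),
        (2, [], [Form_fm a, Form_fm b], gImp (gImp (gNeg a) (gNeg b)) (gImp b a)),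
        (3, [], [Form_fm a, Term_fm w, Subst_fm Zero w a c], gImp (gAll a) c),
        (2, [], [Form_fm a, Form_fm b], gImp (gAll (gImp a b)) (gImp (gAll a) (gAll b))),
        (2, [], [Form_fm a, Lift_fm Zero a b], gImp a (gAll b)),
        (2, [gImp a b, a], [], b),
        (1, [a], [], gAll a)]))"

text \<open>
  For a formula \<open>A\<close> with free variable \<open>x\<close>: the negation of the sentence obtained from \<open>A\<close> by
  substituting for \<open>x\<close> the numeral of (the value of) \<open>t\<close> is provable.
\<close>

definition Prov_neg_dot_fm :: "fm \<Rightarrow> nat \<Rightarrow> tm \<Rightarrow> fm" where
  "Prov_neg_dot_fm A x t =
    (\<^bold>\<exists>\<^bold>\<exists>(Num_fm (wk 2 t) (Var 1) \<^bold>\<and>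
       Subst_fm (num x) (Var 1) (num (gn A)) (Var 0) \<^bold>\<and>
       Prov_fm (gNeg (Var 0))))"

end

theory Submission
  imports Defs "HOL-Number_Theory.Cong" "HOL-Library.Countable_Set"
begin

text \<open>
  Let \<open>P\<close> be the set of all \<open>t\<close> for which \<open>\<^bold>\<not> R(t)\<close> is provable.  In the standard model,
  \<open>R(n)\<close> says that \<open>P\<close> has at least \<open>n + 1\<close> elements.  Peano arithmetic proves that \<open>R(n + 1)\<close>
  implies \<open>R(n)\<close>, since the last term of a sequence can be dropped.  So if \<open>n \<in> P\<close>, then
  all \<open>m \<ge> n\<close> belong to \<open>P\<close>; hence \<open>P\<close> is infinite and \<open>R(n)\<close> is true, whereas its negation
  is provable: a contradiction to soundness.  Thus \<open>P\<close> is empty, so every \<open>R(n)\<close> is false and,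
  again by soundness, not provable.

  The implication from \<open>R(n + 1)\<close> to \<open>R(n)\<close> is verified in all models and transferred to a
  formal proof by the completeness theorem, which avoids derivations in the Hilbert calculus.
\<close>

section \<open>Simultaneous substitution\<close>

text \<open>In an arbitrary model the coded sequences and proofs may be nonstandard, so the step
  from n + 1 to n must not depend on what they mean. It does not: in a fixed model
  \<open>Prov_neg_dot_fm R x\<close> merely describes some set of elements, and a witness for n + 1
  is turned into one for n over that same set. The coding makes this cheap: the length is a separate
  component of <l, <a, b>>, so lowering it while keeping a and b deletes the last term. No new code
  is built inside a model, and the Chinese remainder theorem is used for the standard model only;
  the models mainly have to supply that pairing is injective and grows with l. The standard model
  needs the other half of the work: formulas built by \<open>Derivation_fm\<close> define exactly
  the sets generated by their rules, whence \<open>Prov_fm\<close> holds of the codes of theorems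
  and of nothing else. The final contradiction is a matter of counting: R(t) asks for t + 1 members
  of P, and an upward closed P containing t contains t, ..., 2t.\<close>

primrec sub_tm :: "(nat \<Rightarrow> tm) \<Rightarrow> tm \<Rightarrow> tm" where
  "sub_tm \<sigma> (Var i) = \<sigma> i"
| "sub_tm \<sigma> Zero = Zero"
| "sub_tm \<sigma> (Succ t) = Succ (sub_tm \<sigma> t)"
| "sub_tm \<sigma> (t \<^bold>+ u) = sub_tm \<sigma> t \<^bold>+ sub_tm \<sigma> u"
| "sub_tm \<sigma> (t \<^bold>* u) = sub_tm \<sigma> t \<^bold>* sub_tm \<sigma> u"

definition up :: "(nat \<Rightarrow> tm) \<Rightarrow> nat \<Rightarrow> tm" where
  "up \<sigma> = case_nat (Var 0) (\<lambda>i. sub_tm (\<lambda>j. Var (Suc j)) (\<sigma> i))"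

lemma up_simps [simp]:
  "up \<sigma> 0 = Var 0" "up \<sigma> (Suc i) = sub_tm (\<lambda>j. Var (Suc j)) (\<sigma> i)"
  by (simp_all add: up_def)

text \<open>\<open>lift\<close> and \<open>subst\<close> are both instances of this operation
  (\<open>lift_sub\<close>, \<open>subst_sub\<close>). All interchange laws between them then follow
  from the single composition law \<open>sub_sub\<close> by comparing substitutions variable by
  variable.\<close>

primrec sub :: "(nat \<Rightarrow> tm) \<Rightarrow> fm \<Rightarrow> fm" where
  "sub \<sigma> (t \<^bold>= u) = (sub_tm \<sigma> t \<^bold>= sub_tm \<sigma> u)"
| "sub \<sigma> (\<^bold>\<not> A) = (\<^bold>\<not> sub \<sigma> A)"
| "sub \<sigma> (A \<^bold>\<longrightarrow> B) = (sub \<sigma> A \<^bold>\<longrightarrow> sub \<sigma> B)"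
| "sub \<sigma> (\<^bold>\<forall>A) = (\<^bold>\<forall>(sub (up \<sigma>) A))"

lemma sub_tm_cong: "(\<And>i. i \<in> fv_tm t \<Longrightarrow> \<sigma> i = \<tau> i) \<Longrightarrow> sub_tm \<sigma> t = sub_tm \<tau> t"
  by (induction t) auto

lemma sub_cong: "(\<And>i. i \<in> fv A \<Longrightarrow> \<sigma> i = \<tau> i) \<Longrightarrow> sub \<sigma> A = sub \<tau> A"
proof (induction A arbitrary: \<sigma> \<tau>)
  case (Eq t u)
  then show ?case by (auto intro: sub_tm_cong)
next
  case (Imp A B)
  show ?case using Imp.IH[of \<sigma> \<tau>] Imp.prems by simp
next
  case (All A)
  have "up \<sigma> i = up \<tau> i" if "i \<in> fv A" for i
    using that All.prems by (cases i) auto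
  then have "sub (up \<sigma>) A = sub (up \<tau>) A" by (rule All.IH)
  then show ?case by simp
next
  case (Neg A)
  show ?case using Neg.IH[of \<sigma> \<tau>] Neg.prems by simp
qed

lemma sub_tm_Var [simp]: "sub_tm Var t = t"
  by (induction t) auto

lemma up_Var [simp]: "up Var = Var"
proof
  show "up Var i = Var i" for i by (cases i) auto
qed

lemma sub_Var [simp]: "sub Var A = A"
  by (induction A) auto

lemma sub_tm_sub_tm: "sub_tm \<sigma> (sub_tm \<tau> t) = sub_tm (\<lambda>i. sub_tm \<sigma> (\<tau> i)) t"
  by (induction t) auto

lemma up_comp: "sub_tm (up \<sigma>) (up \<tau> i) = up (\<lambda>i. sub_tm \<sigma> (\<tau> i)) i"
  by (cases i) (simp_all add: sub_tm_sub_tm)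

lemma sub_sub: "sub \<sigma> (sub \<tau> A) = sub (\<lambda>i. sub_tm \<sigma> (\<tau> i)) A"
  by (induction A arbitrary: \<sigma> \<tau>) (simp_all add: sub_tm_sub_tm up_comp)

lemma sub_closed: "fv A = {} \<Longrightarrow> sub \<sigma> A = A"
  using sub_cong[of A \<sigma> Var] by simp

definition shift_at :: "nat \<Rightarrow> nat \<Rightarrow> tm" where
  "shift_at c i = Var (if i < c then i else Suc i)"

definition single_at :: "nat \<Rightarrow> tm \<Rightarrow> nat \<Rightarrow> tm" where
  "single_at c w i = (if i < c then Var i else if i = c then w else Var (i - 1))"

lemma lift_tm_sub: "lift_tm c t = sub_tm (shift_at c) t"
  by (induction t) (auto simp: shift_at_def)

lemma up_shift_at: "up (shift_at c) = shift_at (Suc c)"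
proof
  show "up (shift_at c) i = shift_at (Suc c) i" for i by (cases i) (auto simp: shift_at_def)
qed

lemma lift_sub: "lift c A = sub (shift_at c) A"
  by (induction A arbitrary: c) (auto simp: lift_tm_sub up_shift_at)

lemma subst_tm_sub: "subst_tm c w t = sub_tm (single_at c w) t"
  by (induction t) (auto simp: single_at_def)

lemma shift_at_0 [simp]: "shift_at 0 = (\<lambda>i. Var (Suc i))"
  by (auto simp: shift_at_def)

lemma up_single_at: "up (single_at c w) = single_at (Suc c) (lift_tm 0 w)"
proof
  show "up (single_at c w) i = single_at (Suc c) (lift_tm 0 w) i" for i
    by (cases i) (auto simp: single_at_def lift_tm_sub)
qed

lemma subst_sub: "subst c w A = sub (single_at c w) A"
  by (induction A arbitrary: c w) (auto simp: subst_tm_sub up_single_at)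

lemma single_at_0 [simp]: "single_at 0 w 0 = w" "single_at 0 w (Suc i) = Var i"
  by (auto simp: single_at_def)

lemma sub_subst0: "sub \<sigma> (subst 0 w A) = subst 0 (sub_tm \<sigma> w) (sub (up \<sigma>) A)"
proof -
  have "sub_tm \<sigma> (single_at 0 w i) = sub_tm (single_at 0 (sub_tm \<sigma> w)) (up \<sigma> i)" for i
    by (cases i) (simp_all add: sub_tm_sub_tm)
  then show ?thesis by (simp add: subst_sub sub_sub)
qed

lemma sub_lift0: "sub (up \<sigma>) (lift 0 A) = lift 0 (sub \<sigma> A)"
  by (simp add: lift_sub sub_sub)

text \<open>Needed so that a substitution instance of an induction axiom is again an induction
  axiom.\<close>

lemma sub_induction_step:
  "sub (up \<sigma>) (subst 0 (Succ (Var 0)) (lift 1 A)) = subst 0 (Succ (Var 0)) (lift 1 (sub (up \<sigma>) A))"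
proof -
  have "sub_tm (up \<sigma>) (sub_tm (single_at 0 (Succ (Var 0))) (shift_at 1 i)) =
    sub_tm (\<lambda>i. sub_tm (single_at 0 (Succ (Var 0))) (shift_at 1 i)) (up \<sigma> i)" for i
    by (cases i) (simp_all add: sub_tm_sub_tm shift_at_def)
  then show ?thesis by (simp add: subst_sub lift_sub sub_sub sub_tm_sub_tm)
qed

text \<open>Proofs can be substituted into line by line: the basic axioms are sentences, every
  schema is closed under \<open>sub\<close>, and under \<open>Gen\<close> the substitution continues
  as \<open>up \<sigma>\<close>. This is why the claim is general in
  \<open>\<sigma>\<close>.\<close>

lemma PA_sub: "\<turnstile> A \<Longrightarrow> \<turnstile> sub \<sigma> A"
proof (induction A arbitrary: \<sigma> rule: PA.induct)
  case (basic A)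
  have "fv A = {}"
    using basic by (auto simp: basic_axioms_def)
  then show ?case using basic by (simp add: sub_closed PA.basic)
next
  case (induction A)
  show ?case
    using PA.induction[of "sub (up \<sigma>) A"]
    by (simp add: sub_subst0[where w = Zero] sub_induction_step[simplified])
next
  case (K A B) show ?case by (simp add: PA.K)
next
  case (S A B C) show ?case by (simp add: PA.S)
next
  case (contra A B) show ?case by (simp add: PA.contra)
next
  case (inst A w) show ?case by (simp add: sub_subst0 PA.inst)
next
  case (dist A B) show ?case by (simp add: PA.dist)
next
  case (vacuous A) show ?case by (simp add: sub_lift0 PA.vacuous)
next
  case (MP A B) then show ?case by (auto intro: PA.MP)
next
  case (Gen A) then show ?case by (simp add: PA.Gen)
qed

section \<open>Interpretations\<close>

record 'a interp =
  zero :: 'a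
  succ :: "'a \<Rightarrow> 'a"
  add :: "'a \<Rightarrow> 'a \<Rightarrow> 'a"
  mul :: "'a \<Rightarrow> 'a \<Rightarrow> 'a"

primrec eval :: "'a interp \<Rightarrow> (nat \<Rightarrow> 'a) \<Rightarrow> tm \<Rightarrow> 'a" where
  "eval M e (Var i) = e i"
| "eval M e Zero = zero M"
| "eval M e (Succ t) = succ M (eval M e t)"
| "eval M e (t \<^bold>+ u) = add M (eval M e t) (eval M e u)"
| "eval M e (t \<^bold>* u) = mul M (eval M e t) (eval M e u)"

primrec sat :: "'a interp \<Rightarrow> (nat \<Rightarrow> 'a) \<Rightarrow> fm \<Rightarrow> bool" where
  "sat M e (t \<^bold>= u) \<longleftrightarrow> eval M e t = eval M e u"
| "sat M e (\<^bold>\<not> A) \<longleftrightarrow> \<not> sat M e A"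
| "sat M e (A \<^bold>\<longrightarrow> B) \<longleftrightarrow> (sat M e A \<longrightarrow> sat M e B)"
| "sat M e (\<^bold>\<forall>A) \<longleftrightarrow> (\<forall>a. sat M (case_nat a e) A)"

lemma sat_derived [simp]:
  "sat M e (A \<^bold>\<and> B) \<longleftrightarrow> sat M e A \<and> sat M e B"
  "sat M e (A \<^bold>\<or> B) \<longleftrightarrow> sat M e A \<or> sat M e B"
  "sat M e (A \<^bold>\<longleftrightarrow> B) \<longleftrightarrow> (sat M e A \<longleftrightarrow> sat M e B)"
  "sat M e (\<^bold>\<exists>A) \<longleftrightarrow> (\<exists>a. sat M (case_nat a e) A)"
  by (auto simp: And_def Or_def Iff_def Ex_def)

lemma eval_cong: "(\<And>i. i \<in> fv_tm t \<Longrightarrow> e i = e' i) \<Longrightarrow> eval M e t = eval M e' t"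
  by (induction t) auto

lemma sat_cong: "(\<And>i. i \<in> fv A \<Longrightarrow> e i = e' i) \<Longrightarrow> sat M e A \<longleftrightarrow> sat M e' A"
proof (induction A arbitrary: e e')
  case (Eq t u)
  then show ?case using eval_cong[of t e e' M] eval_cong[of u e e' M] by simp
next
  case (Imp A B)
  show ?case using Imp.IH[of e e'] Imp.prems by simp
next
  case (All A)
  have "sat M (case_nat a e) A \<longleftrightarrow> sat M (case_nat a e') A" for a
    by (rule All.IH) (use All.prems in \<open>auto split: nat.split\<close>)
  then show ?case by simp
next
  case (Neg A)
  show ?case using Neg.IH[of e e'] Neg.prems by simp
qed

lemma eval_sub_tm: "eval M e (sub_tm \<sigma> t) = eval M (\<lambda>i. eval M e (\<sigma> i)) t"
  by (induction t) auto

lemma sat_sub: "sat M e (sub \<sigma> A) \<longleftrightarrow> sat M (\<lambda>i. eval M e (\<sigma> i)) A"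
proof (induction A arbitrary: e \<sigma>)
  case (All A)
  have "(\<lambda>i. eval M (case_nat a e) (up \<sigma> i)) = case_nat a (\<lambda>i. eval M e (\<sigma> i))" for a
    by (auto simp: eval_sub_tm split: nat.split)
  then show ?case by (simp add: All.IH)
qed (simp_all add: eval_sub_tm)

lemma sat_subst0: "sat M e (subst 0 w A) \<longleftrightarrow> sat M (case_nat (eval M e w) e) A"
proof -
  have "(\<lambda>i. eval M e (single_at 0 w i)) = case_nat (eval M e w) e"
    by (auto split: nat.split)
  then show ?thesis by (simp add: subst_sub sat_sub)
qed

lemma sat_lift0 [simp]: "sat M (case_nat a e) (lift 0 A) \<longleftrightarrow> sat M e A"
  by (simp add: lift_sub sat_sub)

lemma eval_lift_tm0 [simp]: "eval M (case_nat a e) (lift_tm 0 t) = eval M e t"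
  by (simp add: lift_tm_sub eval_sub_tm)

lemma sat_induction_step:
  "sat M (case_nat a e) (subst 0 (Succ (Var 0)) (lift 1 A)) \<longleftrightarrow> sat M (case_nat (succ M a) e) A"
proof -
  have "(\<lambda>i. eval M (case_nat (succ M a) (case_nat a e)) (shift_at (Suc 0) i)) = case_nat (succ M a) e"
    by (auto simp: shift_at_def split: nat.split)
  then show ?thesis by (simp add: sat_subst0 lift_sub sat_sub)
qed

text \<open>The right-hand environment \<open>e'\<close> is unrelated to \<open>e\<close>: with
  \<open>x\<close> the only free variable, neither the other values nor the decrementing done by
  \<open>subst\<close> can be noticed.\<close>

lemma sat_subst_only:
  assumes "fv A \<subseteq> {x}"
  shows "sat M e (subst x w A) \<longleftrightarrow> sat M (e'(x := eval M e w)) A"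
  unfolding subst_sub sat_sub
  by (rule sat_cong) (use assms in \<open>auto simp: single_at_def\<close>)

definition NN :: "nat interp" where
  "NN = \<lparr>zero = 0, succ = Suc, add = (+), mul = (*)\<rparr>"

lemma NN_simps [simp]:
  "zero NN = 0" "succ NN = Suc" "add NN = (+)" "mul NN = (*)"
  by (simp_all add: NN_def)

lemma eval_num_NN [simp]: "eval NN e (num n) = n"
  by (induction n) auto

theorem PA_sound: "\<turnstile> A \<Longrightarrow> sat NN e A"
proof (induction A arbitrary: e rule: PA.induct)
  case (basic A)
  then show ?case by (auto simp: basic_axioms_def algebra_simps)
next
  case (induction A)
  have "sat NN (case_nat n e) A"
    if "sat NN (case_nat 0 e) A" "\<And>n. sat NN (case_nat n e) A \<longrightarrow> sat NN (case_nat (Suc n) e) A" for n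
    by (induction n) (use that in auto)
  then show ?case
    unfolding sat.simps sat_subst0[where w = Zero] sat_induction_step eval.simps NN_simps by blast
next
  case (inst A w)
  then show ?case by (simp add: sat_subst0)
qed auto

section \<open>Goedel numbers are unique\<close>

text \<open>Locates \<open>pair x y\<close> in the gap from the square of x + y up to the next
  square, so that the sum x + y, and with it x and y, can be recovered.\<close>

lemma square_add_less:
  fixes u v x :: nat
  assumes "u < v" "x \<le> u"
  shows "u * u + x < v * v"
proof -
  have "u * u + x < (u + 1) * (u + 1)" using assms by simp
  also have "\<dots> \<le> v * v" using assms by (intro mult_mono) auto
  finally show ?thesis .
qed

lemma pair_eq_iff [simp]: "pair x y = pair u v \<longleftrightarrow> x = u \<and> y = v"
proof
  assume eq: "pair x y = pair u v"
  have "x + y = u + v"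
    using square_add_less[of "x + y" "u + v" x] square_add_less[of "u + v" "x + y" u] eq
    unfolding pair_def by (metis le_add1 linorder_neqE_nat not_add_less1 trans_less_add1)
  with eq show "x = u \<and> y = v" by (auto simp: pair_def)
qed simp

lemma gn_tm_eq_iff [simp]: "gn_tm t = gn_tm u \<longleftrightarrow> t = u"
proof (induction t arbitrary: u)
  case (Var i) show ?case by (cases u) auto
next
  case Zero show ?case by (cases u) auto
next
  case (Succ t) then show ?case by (cases u) auto
next
  case (Add t1 t2) then show ?case by (cases u) auto
next
  case (Mul t1 t2) then show ?case by (cases u) auto
qed

lemma gn_eq_iff [simp]: "gn A = gn B \<longleftrightarrow> A = B"
proof (induction A arbitrary: B)
  case (Eq t u) show ?case by (cases B) auto
next
  case (Neg A) then show ?case by (cases B) auto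
next
  case (Imp A1 A2) then show ?case by (cases B) auto
next
  case (All A) then show ?case by (cases B) auto
qed

section \<open>Completeness\<close>

text \<open>Generalization is confined to theorems of PA and never applied to hypotheses. Hence the
  deduction theorem holds without side conditions, and free variables of \<open>G\<close> behave
  like constants, which lets them serve as Henkin witnesses.\<close>

inductive ded :: "fm set \<Rightarrow> fm \<Rightarrow> bool" for G where
  hyp: "A \<in> G \<Longrightarrow> ded G A"
| provable: "\<turnstile> A \<Longrightarrow> ded G A"
| mp: "ded G (A \<^bold>\<longrightarrow> B) \<Longrightarrow> ded G A \<Longrightarrow> ded G B"

lemma PA_refl: "\<turnstile> A \<^bold>\<longrightarrow> A"
  using MP[OF MP[OF PA.S PA.K] PA.K] .

lemma deduction: "ded (insert A G) B \<Longrightarrow> ded G (A \<^bold>\<longrightarrow> B)"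
proof (induction rule: ded.induct)
  case (hyp B)
  then show ?case by (metis PA.K PA_refl ded.hyp ded.provable ded.mp insert_iff)
next
  case (provable B)
  then show ?case by (metis PA.K ded.provable ded.mp)
next
  case (mp B C)
  then show ?case by (metis PA.S ded.provable ded.mp)
qed

lemma ded_mono: "ded G A \<Longrightarrow> G \<subseteq> H \<Longrightarrow> ded H A"
  by (induction rule: ded.induct) (auto intro: ded.intros)

lemma ded_explosion: "ded G A \<Longrightarrow> ded G (\<^bold>\<not> A) \<Longrightarrow> ded G B"
  by (metis PA.K PA.contra ded.provable ded.mp)

definition con :: "fm set \<Rightarrow> bool" where
  "con G \<longleftrightarrow> (\<exists>A. \<not> ded G A)"

text \<open>An inconsistent hypothesis \<open>Neg A\<close> yields in particular the negation of the
  theorem \<open>A\<close> implies \<open>A\<close>; axiom \<open>contra\<close> reverses this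
  implication.\<close>

lemma ded_if_not_con_Neg:
  assumes "\<not> con (insert (\<^bold>\<not> A) G)"
  shows "ded G A"
proof -
  have "ded G (\<^bold>\<not> A \<^bold>\<longrightarrow> \<^bold>\<not> (A \<^bold>\<longrightarrow> A))"
    using assms by (auto simp: con_def intro: deduction)
  then show ?thesis by (metis PA.contra PA_refl ded.provable ded.mp)
qed

lemma ded_Neg_Neg: "ded G (\<^bold>\<not> \<^bold>\<not> A) \<Longrightarrow> ded G A"
  by (rule ded_if_not_con_Neg)
    (metis con_def ded.hyp ded_explosion ded_mono insertI1 subset_insertI)

lemma ded_Neg_if_not_con:
  assumes "\<not> con (insert A G)"
  shows "ded G (\<^bold>\<not> A)"
proof (rule ded_if_not_con_Neg)
  have "ded (insert (\<^bold>\<not> \<^bold>\<not> A) G) B" for B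
  proof -
    have "ded G (A \<^bold>\<longrightarrow> B)" using assms by (auto simp: con_def intro: deduction)
    then show ?thesis by (meson ded.hyp ded.mp ded_Neg_Neg ded_mono insertI1 subset_insertI)
  qed
  then show "\<not> con (insert (\<^bold>\<not> \<^bold>\<not> A) G)" by (simp add: con_def)
qed

text \<open>
  The renaming moves the fresh variable \<open>i\<close> to position 0, where it can be generalized; on the
  other variables it is a shift, so it acts on \<open>G\<close> as \<open>lift 0\<close>.
\<close>

lemma ded_All_rename:
  assumes "ded G A" and fresh: "\<And>B. B \<in> G \<Longrightarrow> i \<notin> fv B"
  shows "ded G (\<^bold>\<forall>(sub (\<lambda>j. if j = i then Var 0 else Var (Suc j)) A))"
  using assms(1)
proof (induction rule: ded.induct)
  case (hyp A)
  have "sub (\<lambda>j. if j = i then Var 0 else Var (Suc j)) A = lift 0 A"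
    unfolding lift_sub by (rule sub_cong) (use fresh[OF hyp] in auto)
  then show ?case using hyp by (metis PA.vacuous ded.hyp ded.provable ded.mp)
next
  case (provable A)
  then show ?case by (intro ded.provable PA.Gen PA_sub)
next
  case (mp A B)
  then show ?case using PA.dist by (metis ded.provable ded.mp sub.simps(3))
qed

text \<open>The renaming of \<open>ded_All_rename\<close> undoes the instantiation by
  \<open>Var i\<close>: the composite is the identity on the variables of \<open>A\<close>, because
  \<open>i\<close> does not already occur in the quantified formula.\<close>

lemma ded_AllI:
  assumes "ded G (subst 0 (Var i) A)"
    and "\<And>B. B \<in> G \<Longrightarrow> i \<notin> fv B" and fresh: "i \<notin> fv (\<^bold>\<forall>A)"
  shows "ded G (\<^bold>\<forall>A)"
proof -
  let ?\<rho> = "\<lambda>j. if j = i then Var 0 else Var (Suc j)"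
  have "sub ?\<rho> (subst 0 (Var i) A) = sub Var A"
    unfolding subst_sub sub_sub
  proof (rule sub_cong)
    fix j
    assume "j \<in> fv A"
    then show "sub_tm ?\<rho> (single_at 0 (Var i) j) = Var j"
      using fresh by (cases j) auto
  qed
  then show ?thesis using ded_All_rename[OF assms(1,2)] by simp
qed

section \<open>Henkin sets with variables as witnesses\<close>

lemma finite_fv_tm [simp]: "finite (fv_tm t)"
  by (induction t) auto

lemma finite_fv [simp]: "finite (fv A)"
proof (induction A)
  case (All A)
  then have "finite (Suc -` fv A)" by (intro finite_vimageI) auto
  then show ?case by (simp add: vimage_def)
qed auto

text \<open>The last clause is the Henkin condition: a rejected universal formula comes with a
  rejected instance. The witness is a variable, so the language need not be extended by
  constants.\<close>

definition decides :: "fm \<Rightarrow> fm set \<Rightarrow> bool" where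
  "decides A G \<longleftrightarrow> A \<in> G \<or>
    (\<^bold>\<not> A) \<in> G \<and> (\<forall>B. A = (\<^bold>\<forall>B) \<longrightarrow> (\<exists>i. (\<^bold>\<not> subst 0 (Var i) B) \<in> G))"

text \<open>Finiteness of \<open>G\<close> guarantees a variable \<open>i\<close> fresh for it. If
  the negated instance at \<open>i\<close> were inconsistent with the rest, \<open>ded_AllI\<close>
  would derive the universal formula that was just rejected.\<close>

lemma con_extend:
  assumes "finite G" "con G"
  shows "\<exists>G'. finite G' \<and> con G' \<and> G \<subseteq> G' \<and> decides A G'"
proof (cases "con (insert A G)")
  case True
  then show ?thesis using assms by (intro exI[of _ "insert A G"]) (auto simp: decides_def)
next
  case False
  then have neg: "ded G (\<^bold>\<not> A)" by (rule ded_Neg_if_not_con)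
  have conN: "con (insert (\<^bold>\<not> A) G)"
    using assms(2) ded.mp[OF deduction neg] unfolding con_def by blast
  show ?thesis
  proof (cases "\<exists>B. A = (\<^bold>\<forall>B)")
    case False
    then show ?thesis using assms conN
      by (intro exI[of _ "insert (\<^bold>\<not> A) G"]) (auto simp: decides_def)
  next
    case True
    then obtain B where A: "A = (\<^bold>\<forall>B)" by blast
    let ?G = "insert (\<^bold>\<not> A) G"
    have "finite (\<Union>(fv ` ?G))" using assms by auto
    then obtain i where i: "i \<notin> \<Union>(fv ` ?G)" using ex_new_if_finite infinite_UNIV_nat by blast
    have "con (insert (\<^bold>\<not> subst 0 (Var i) B) ?G)"
    proof (rule ccontr)
      assume "\<not> ?thesis"
      then have "ded ?G (subst 0 (Var i) B)" by (rule ded_if_not_con_Neg)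
      then have "ded ?G (\<^bold>\<forall>B)" by (rule ded_AllI) (use i A in auto)
      then have "ded ?G C" for C using ded_explosion[of ?G A] A by (auto intro: ded.hyp)
      then show False using conN by (auto simp: con_def)
    qed
    then show ?thesis using assms A
      by (intro exI[of _ "insert (\<^bold>\<not> subst 0 (Var i) B) ?G"]) (auto simp: decides_def)
  qed
qed

text \<open>Goedel numbers enumerate the formulas: stage n + 1 settles the formula with number n, if
  there is one. All stages stay finite, so fresh witnesses never run out.\<close>

lemma henkin_extension:
  assumes "finite G" "con G"
  obtains H where "G \<subseteq> H" "con H" "\<And>A. decides A H"
proof -
  let ?P = "\<lambda>n F. finite F \<and> con F \<and> G \<subseteq> F"
  let ?Q = "\<lambda>n F F'. F \<subseteq> F' \<and> (\<forall>A. gn A = n \<longrightarrow> decides A F')"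
  have ex: "\<exists>F'. ?P (Suc n) F' \<and> ?Q n F F'" if F: "?P n F" for n F
  proof (cases "\<exists>A. gn A = n")
    case True
    then obtain A where A: "gn A = n" by blast
    with con_extend[of F A] F obtain F' where "finite F' \<and> con F' \<and> F \<subseteq> F' \<and> decides A F'" by auto
    with A F show ?thesis by (intro exI[of _ F']) auto
  next
    case False
    with F show ?thesis by blast
  qed
  obtain F where F: "\<And>n. ?P n (F n)" "\<And>n. ?Q n (F n) (F (Suc n))"
    using dependent_nat_choice[of ?P ?Q] assms ex by (metis subset_refl)
  have mono: "F m \<subseteq> F n" if "m \<le> n" for m n
    using lift_Suc_mono_le[of F, OF _ that] F(2) by blast
  \<comment> \<open>Compactness: a derivation uses finitely many hypotheses, so by monotonicity a
    single stage contains them all.\<close>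
  have stage: "\<exists>n. ded (F n) A" if "ded (\<Union>n. F n) A" for A
    using that
  proof (induction rule: ded.induct)
    case (mp A B)
    then obtain m n where "ded (F m) (A \<^bold>\<longrightarrow> B)" "ded (F n) A" by blast
    then have "ded (F (max m n)) (A \<^bold>\<longrightarrow> B)" "ded (F (max m n)) A"
      using mono by (meson ded_mono max.cobounded1 max.cobounded2)+
    then show ?case by (blast intro: ded.mp)
  qed (auto intro: ded.intros)
  show thesis
  proof
    show "G \<subseteq> (\<Union>n. F n)" using F(1) by blast
    show "con (\<Union>n. F n)"
    proof (rule ccontr)
      assume "\<not> ?thesis"
      then have "\<And>A. ded (\<Union>n. F n) A" by (auto simp: con_def)
      \<comment> \<open>The stage depends on the formula derived, so one refutable formula is fixed;
        the stage deriving it then derives everything.\<close>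
      then obtain n where "ded (F n) (\<^bold>\<not> (Zero \<^bold>= Zero \<^bold>\<longrightarrow> Zero \<^bold>= Zero))" using stage by blast
      then have "ded (F n) C" for C using PA_refl ded.provable ded_explosion by blast
      then show False using F(1) by (auto simp: con_def)
    qed
    show "decides A (\<Union>n. F n)" for A
    proof -
      have "decides A (F (Suc (gn A)))" using F(2) by blast
      then show ?thesis unfolding decides_def by blast
    qed
  qed
qed

section \<open>Equality axioms and the term model\<close>

lemma basic_axiom_inst:
  "\<turnstile> t \<^bold>= t"
  "\<turnstile> t \<^bold>= u \<^bold>\<longrightarrow> t \<^bold>= v \<^bold>\<longrightarrow> u \<^bold>= v"
  "\<turnstile> t \<^bold>= u \<^bold>\<longrightarrow> Succ t \<^bold>= Succ u"
  "\<turnstile> t \<^bold>= u \<^bold>\<longrightarrow> v \<^bold>= w \<^bold>\<longrightarrow> t \<^bold>+ v \<^bold>= u \<^bold>+ w"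
  "\<turnstile> t \<^bold>= u \<^bold>\<longrightarrow> v \<^bold>= w \<^bold>\<longrightarrow> t \<^bold>* v \<^bold>= u \<^bold>* w"
  "\<turnstile> \<^bold>\<not> Succ t \<^bold>= Zero"
  "\<turnstile> Succ t \<^bold>= Succ u \<^bold>\<longrightarrow> t \<^bold>= u"
proof -
  have AllD: "\<turnstile> sub \<sigma> A" if "\<turnstile> \<^bold>\<forall>A" for \<sigma> A
  proof -
    have "\<turnstile> subst 0 (\<sigma> 0) (sub (up (\<lambda>i. \<sigma> (Suc i))) A)"
      using PA_sub[OF that, of "\<lambda>i. \<sigma> (Suc i)"] PA.MP[OF PA.inst] by simp
    moreover have "sub_tm (single_at 0 (\<sigma> 0)) (up (\<lambda>i. \<sigma> (Suc i)) i) = \<sigma> i" for i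
      by (cases i) (simp_all add: sub_tm_sub_tm)
    ultimately show ?thesis by (simp add: subst_sub sub_sub)
  qed
  have D2: "\<turnstile> sub \<sigma> A" if "\<turnstile> \<^bold>\<forall>\<^bold>\<forall>A" for \<sigma> A using AllD AllD[OF that, of Var] by simp
  have D3: "\<turnstile> sub \<sigma> A" if "\<turnstile> \<^bold>\<forall>\<^bold>\<forall>\<^bold>\<forall>A" for \<sigma> A using D2 AllD[OF that, of Var] by simp
  have D4: "\<turnstile> sub \<sigma> A" if "\<turnstile> \<^bold>\<forall>\<^bold>\<forall>\<^bold>\<forall>\<^bold>\<forall>A" for \<sigma> A using D3 AllD[OF that, of Var] by simp
  \<comment> \<open>Arguments are listed from the outermost quantifier to the innermost, which is
    \<open>Var 0\<close>. For axioms with fewer than four quantifiers the leading arguments are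
    padding.\<close>
  let ?\<sigma> = "\<lambda>a b c d. case_nat d (case_nat c (case_nat b (case_nat a Var)))"
  have ax: "i < length basic_axioms \<Longrightarrow> \<turnstile> basic_axioms ! i" for i
    by (simp add: PA.basic)
  show "\<turnstile> t \<^bold>= t"
    using AllD[of _ "case_nat t Var", OF ax[of 0, simplified basic_axioms_def, simplified]] by simp
  show "\<turnstile> t \<^bold>= u \<^bold>\<longrightarrow> t \<^bold>= v \<^bold>\<longrightarrow> u \<^bold>= v"
    using D3[of _ "?\<sigma> t t u v", OF ax[of 1, simplified basic_axioms_def, simplified]] by simp
  show "\<turnstile> t \<^bold>= u \<^bold>\<longrightarrow> Succ t \<^bold>= Succ u"
    using D2[of _ "?\<sigma> t t t u", OF ax[of 2, simplified basic_axioms_def, simplified]] by simp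
  show "\<turnstile> t \<^bold>= u \<^bold>\<longrightarrow> v \<^bold>= w \<^bold>\<longrightarrow> t \<^bold>+ v \<^bold>= u \<^bold>+ w"
    using D4[of _ "?\<sigma> t u v w", OF ax[of 3, simplified basic_axioms_def, simplified]] by simp
  show "\<turnstile> t \<^bold>= u \<^bold>\<longrightarrow> v \<^bold>= w \<^bold>\<longrightarrow> t \<^bold>* v \<^bold>= u \<^bold>* w"
    using D4[of _ "?\<sigma> t u v w", OF ax[of 4, simplified basic_axioms_def, simplified]] by simp
  show "\<turnstile> \<^bold>\<not> Succ t \<^bold>= Zero"
    using AllD[of _ "case_nat t Var", OF ax[of 5, simplified basic_axioms_def, simplified]] by simp
  show "\<turnstile> Succ t \<^bold>= Succ u \<^bold>\<longrightarrow> t \<^bold>= u"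
    using D2[of _ "?\<sigma> t t t u", OF ax[of 6, simplified basic_axioms_def, simplified]] by simp
qed

text \<open>Henkin's construction: terms modulo the equations in a complete consistent set
  containing the negation of \<open>A\<close>. There are countably infinitely many classes, so the
  model can be renumbered to have carrier \<open>nat\<close>, and models of this one type
  suffice.\<close>

theorem PA_completeness:
  assumes valid: "\<And>(M :: nat interp) e. (\<And>B e. \<turnstile> B \<Longrightarrow> sat M e B) \<Longrightarrow> sat M e A"
  shows "\<turnstile> A"
proof (rule ccontr)
  assume nA: "\<not> (\<turnstile> A)"
  have "con {\<^bold>\<not> A}"
  proof (rule ccontr)
    assume "\<not> con {\<^bold>\<not> A}"
    then have "ded {} A" by (rule ded_if_not_con_Neg)
    then have "\<turnstile> A" by (induction rule: ded.induct) (auto intro: PA.MP)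
    with nA show False ..
  qed
  then obtain H where H: "{\<^bold>\<not> A} \<subseteq> H" "con H" "\<And>B. decides B H"
    using henkin_extension[of "{\<^bold>\<not> A}"] by auto
  have Neg: "(\<^bold>\<not> B) \<in> H \<longleftrightarrow> B \<notin> H" for B
    using H(2) H(3)[of B] ded_explosion[of H B] ded.hyp unfolding con_def decides_def by blast
  have ded: "ded H B \<longleftrightarrow> B \<in> H" for B
    using Neg[of B] ded.hyp ded_explosion[of H B] H(2) unfolding con_def by blast
  have mp: "(B \<^bold>\<longrightarrow> C) \<in> H \<Longrightarrow> B \<in> H \<Longrightarrow> C \<in> H" for B C
    using ded by (metis ded.mp)
  have prov: "\<turnstile> B \<Longrightarrow> B \<in> H" for B
    using ded ded.provable by blast
  have Imp: "(B \<^bold>\<longrightarrow> C) \<in> H \<longleftrightarrow> (B \<in> H \<longrightarrow> C \<in> H)" for B C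
    by (metis mp Neg PA.K PA.contra prov)
  \<comment> \<open>Right to left: were the universal formula missing, \<open>decides\<close> would
    supply a variable whose instance is negated in \<open>H\<close>.\<close>
  have All_iff: "(\<^bold>\<forall>B) \<in> H \<longleftrightarrow> (\<forall>t. subst 0 t B \<in> H)" for B
    using H(3)[of "\<^bold>\<forall>B"] Neg mp prov PA.inst unfolding decides_def by blast
  have eq_refl: "(t \<^bold>= t) \<in> H" for t
    by (rule prov basic_axiom_inst)+
  have eq_sym: "(t \<^bold>= u) \<in> H \<Longrightarrow> (u \<^bold>= t) \<in> H" for t u
    using mp prov basic_axiom_inst(2) eq_refl by meson
  have eq_trans: "(t \<^bold>= u) \<in> H \<Longrightarrow> (u \<^bold>= v) \<in> H \<Longrightarrow> (t \<^bold>= v) \<in> H" for t u v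
    using mp prov basic_axiom_inst(2) eq_sym by meson

  define cls where "cls t = {u. (t \<^bold>= u) \<in> H}" for t
  have cls_eq: "cls t = cls u \<longleftrightarrow> (t \<^bold>= u) \<in> H" for t u
    using eq_refl eq_sym eq_trans unfolding cls_def by blast
  \<comment> \<open>Numerals with different values fall into different classes. This makes the
    quotient infinite, as a bijection with all of \<open>nat\<close> requires.\<close>
  have num_neq: "(num m \<^bold>= num n) \<in> H \<longleftrightarrow> m = n" for m n
  proof (induction m arbitrary: n)
    case 0
    show ?case
      using Neg prov[OF basic_axiom_inst(6)] eq_sym eq_refl by (cases n) (simp, metis num.simps nat.distinct(1))
  next
    case (Suc m)
    show ?case
    proof (cases n)
      case 0
      then show ?thesis using Neg prov[OF basic_axiom_inst(6)] by simp
    next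
      case (Suc n')
      have "(Succ (num m) \<^bold>= Succ (num n')) \<in> H \<longleftrightarrow> (num m \<^bold>= num n') \<in> H"
        using mp[OF prov[OF basic_axiom_inst(3)]] mp[OF prov[OF basic_axiom_inst(7)]] by blast
      then show ?thesis using Suc Suc.IH[of n'] by simp
    qed
  qed
  have "inj (\<lambda>n. cls (num n))"
    unfolding inj_def cls_eq num_neq by blast
  then have "infinite (range (\<lambda>n. cls (num n)))"
    by (rule range_inj_infinite)
  then have inf: "infinite (range cls)"
    by (rule infinite_super[rotated]) auto
  have "countable (UNIV :: tm set)"
    by (rule countableI[of gn_tm]) (simp add: inj_on_def)
  then have "bij_betw (to_nat_on (range cls)) (range cls) UNIV"
    using inf by (intro to_nat_on_infinite) auto
  then obtain k where k: "bij_betw k (range cls) (UNIV :: nat set)" by blast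
  define f where "f t = k (cls t)" for t
  have f_eq: "f t = f u \<longleftrightarrow> (t \<^bold>= u) \<in> H" for t u
    unfolding f_def cls_eq[symmetric] by (rule inj_on_eq_iff[OF bij_betw_imp_inj_on[OF k]]) auto
  have surj_f: "surj f"
    using bij_betw_imp_surj_on[OF k] unfolding f_def by (simp add: image_image)
  define g where "g = inv f"
  have fg: "f (g n) = n" for n
    using surj_f by (simp add: g_def surj_f_inv_f)

  \<comment> \<open>The operations act on representatives chosen by \<open>g\<close>; the congruence
    axioms make the choice irrelevant, which is what the equations \<open>M\<close> below
    record.\<close>
  define M where "M = \<lparr>zero = f Zero, succ = (\<lambda>a. f (Succ (g a))),
    add = (\<lambda>a b. f (g a \<^bold>+ g b)), mul = (\<lambda>a b. f (g a \<^bold>* g b))\<rparr>"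
  have gf: "(g (f t) \<^bold>= t) \<in> H" for t
    using f_eq fg by blast
  have M [simp]: "zero M = f Zero" "succ M (f t) = f (Succ t)"
    "add M (f t) (f u) = f (t \<^bold>+ u)" "mul M (f t) (f u) = f (t \<^bold>* u)" for t u
    unfolding M_def using gf mp prov[OF basic_axiom_inst(3)] prov[OF basic_axiom_inst(4)]
      prov[OF basic_axiom_inst(5)] by (simp_all add: f_eq) meson+
  have eval_M: "eval M (\<lambda>i. f (\<sigma> i)) t = f (sub_tm \<sigma> t)" for \<sigma> t
    by (induction t) simp_all
  have sat_M: "sat M (\<lambda>i. f (\<sigma> i)) B \<longleftrightarrow> sub \<sigma> B \<in> H" for \<sigma> B
  proof (induction B arbitrary: \<sigma>)
    case (Eq t u)
    then show ?case by (simp add: eval_M f_eq)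
  next
    case (All B)
    have env: "case_nat (f t) (\<lambda>i. f (\<sigma> i)) = (\<lambda>i. f (case_nat t \<sigma> i))" for t
      by (auto split: nat.split)
    have "sub_tm (single_at 0 t) (up \<sigma> i) = case_nat t \<sigma> i" for t i
      by (cases i) (simp_all add: sub_tm_sub_tm)
    then have sub: "sub (case_nat t \<sigma>) B = subst 0 t (sub (up \<sigma>) B)" for t
      by (simp add: subst_sub sub_sub)
    \<comment> \<open>Every element is the value of a term, so the quantifier may range over the
      elements \<open>f t\<close>.\<close>
    have "sat M (\<lambda>i. f (\<sigma> i)) (\<^bold>\<forall>B) \<longleftrightarrow> (\<forall>t. sat M (case_nat (f t) (\<lambda>i. f (\<sigma> i))) B)"
      using fg by (metis sat.simps(4))
    then show ?case unfolding env All.IH sub by (simp add: All_iff)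
  qed (simp_all add: Neg Imp)
  \<comment> \<open>Choosing representatives, any environment \<open>e\<close> has the form needed
    for \<open>sat_M\<close>, with \<open>g (e i)\<close> as the term for variable i.\<close>
  have "sat M e B" if "\<turnstile> B" for B e
    using sat_M[of "\<lambda>i. g (e i)" B] prov[OF PA_sub[OF that]] by (simp add: fg)
  then have "sat M (\<lambda>i. f (Var i)) A" by (rule valid)
  then show False using sat_M[of Var A] H(1) Neg by auto
qed

section \<open>Meaning of the arithmetical macros\<close>

text \<open>This and the following predicates take an arbitrary interpretation: they are evaluated
  to ordinary notions in \<open>NN\<close> and reasoned about axiomatically in the other models of
  PA.\<close>

definition le :: "'a interp \<Rightarrow> 'a \<Rightarrow> 'a \<Rightarrow> bool" where
  "le M a b \<longleftrightarrow> (\<exists>d. add M d a = b)"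

definition pr :: "'a interp \<Rightarrow> 'a \<Rightarrow> 'a \<Rightarrow> 'a" where
  "pr M a b = add M (mul M (add M a b) (add M a b)) a"

definition beta :: "'a interp \<Rightarrow> 'a \<Rightarrow> 'a \<Rightarrow> 'a \<Rightarrow> 'a \<Rightarrow> bool" where
  "beta M a b k y \<longleftrightarrow> le M (succ M y) (succ M (mul M k b)) \<and>
    (\<exists>q. le M q a \<and> a = add M (mul M q (succ M (mul M k b))) y)"

definition code :: "'a interp \<Rightarrow> 'a \<Rightarrow> 'a \<Rightarrow> 'a \<Rightarrow> 'a \<Rightarrow> bool" where
  "code M z l a b \<longleftrightarrow> le M l z \<and> le M a z \<and> le M b z \<and> z = pr M l (pr M a b)"

definition len :: "'a interp \<Rightarrow> 'a \<Rightarrow> 'a \<Rightarrow> bool" where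
  "len M z n \<longleftrightarrow> (\<exists>a b. le M a z \<and> le M b z \<and> z = pr M n (pr M a b))"

definition dec :: "'a interp \<Rightarrow> 'a \<Rightarrow> 'a \<Rightarrow> 'a \<Rightarrow> bool" where
  "dec M z k y \<longleftrightarrow> (\<exists>l a b. code M z l a b \<and> le M (succ M (zero M)) k \<and> le M k l \<and> beta M a b k y)"

definition het_seq :: "'a interp \<Rightarrow> 'a \<Rightarrow> bool" where
  "het_seq M z \<longleftrightarrow> (\<exists>l a b. code M z l a b) \<and>
    (\<exists>l. le M l z \<and> len M z l \<and>
      (\<forall>u v. le M u l \<longrightarrow> le M v l \<longrightarrow> le M (succ M (zero M)) u \<longrightarrow> le M (succ M (zero M)) v \<longrightarrow>
        u \<noteq> v \<longrightarrow> \<not> (\<exists>y. le M y z \<and> dec M z u y \<and> dec M z v y)))"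

definition ele :: "'a interp \<Rightarrow> 'a \<Rightarrow> 'a \<Rightarrow> bool" where
  "ele M x z \<longleftrightarrow> (\<exists>l a b. code M z l a b) \<and>
    (\<exists>l. le M l z \<and> len M z l \<and> (\<exists>k. le M k l \<and> dec M z k x))"

lemma eval_wk [simp]:
  "eval M e (wk 0 t) = eval M e t"
  "eval M (case_nat a e) (wk (Suc n) t) = eval M e (wk n t)"
  "eval M (case_nat a e) (wk (numeral k) t) = eval M e (wk (pred_numeral k) t)"
  by (simp_all add: wk_def numeral_eq_Suc)

lemma sat_Le [simp]: "sat M e (t \<^bold>\<le> u) \<longleftrightarrow> le M (eval M e t) (eval M e u)"
  by (simp add: Le_def le_def)

lemma sat_Less [simp]: "sat M e (t \<^bold>< u) \<longleftrightarrow> le M (succ M (eval M e t)) (eval M e u)"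
  by (simp add: Less_def)

lemma sat_BAll [simp]:
  "sat M e (BAll t A) \<longleftrightarrow> (\<forall>a. le M a (eval M e t) \<longrightarrow> sat M (case_nat a e) A)"
  by (simp add: BAll_def)

lemma sat_BEx [simp]:
  "sat M e (BEx t A) \<longleftrightarrow> (\<exists>a. le M a (eval M e t) \<and> sat M (case_nat a e) A)"
  by (simp add: BEx_def)

lemma eval_Pair_tm [simp]: "eval M e \<langle>t, u\<rangle> = pr M (eval M e t) (eval M e u)"
  by (simp add: Pair_tm_def pr_def)

lemma sat_Code_fm [simp]: "sat M e (Code_fm z) \<longleftrightarrow> (\<exists>l a b. code M (eval M e z) l a b)"
  by (auto simp add: Code_fm_def code_def Let_def)

lemma sat_Len_fm [simp]: "sat M e (Len_fm z n) \<longleftrightarrow> len M (eval M e z) (eval M e n)"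
  by (auto simp add: Len_fm_def len_def Let_def)

lemma sat_Dec_fm [simp]:
  "sat M e (Dec_fm z k y) \<longleftrightarrow> dec M (eval M e z) (eval M e k) (eval M e y)"
  by (auto simp add: Dec_fm_def dec_def code_def beta_def Let_def)

lemma sat_HetSeq_fm [simp]: "sat M e (HetSeq_fm z) \<longleftrightarrow> het_seq M (eval M e z)"
  by (simp add: HetSeq_fm_def het_seq_def Let_def) blast

lemma sat_Ele_fm [simp]: "sat M e (Ele_fm x z) \<longleftrightarrow> ele M (eval M e x) (eval M e z)"
  by (simp add: Ele_fm_def ele_def Let_def)

section \<open>Free variables of the macros\<close>

lemma fv_derived [simp]:
  "fv (A \<^bold>\<and> B) = fv A \<union> fv B"
  "fv (A \<^bold>\<or> B) = fv A \<union> fv B"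
  "fv (\<^bold>\<exists>A) = {i. Suc i \<in> fv A}"
  by (simp_all add: And_def Or_def Ex_def)

lemma fv_tm_num [simp]: "fv_tm (num n) = {}"
  by (induction n) auto

lemma Suc_in_fv_lift_tm [simp]: "Suc i \<in> fv_tm (lift_tm 0 t) \<longleftrightarrow> i \<in> fv_tm t"
  by (induction t) auto

lemma fv_tm_wk [simp]:
  "fv_tm (wk 0 t) = fv_tm t"
  "Suc i \<in> fv_tm (wk (Suc n) t) \<longleftrightarrow> i \<in> fv_tm (wk n t)"
  "Suc i \<in> fv_tm (wk (numeral k) t) \<longleftrightarrow> i \<in> fv_tm (wk (pred_numeral k) t)"
  by (simp_all add: wk_def numeral_eq_Suc)

lemma fv_Le [simp]: "fv (t \<^bold>\<le> u) = fv_tm t \<union> fv_tm u"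
  by (auto simp: Le_def)

lemma fv_Less [simp]: "fv (t \<^bold>< u) = fv_tm t \<union> fv_tm u"
  by (simp add: Less_def)

lemma fv_BAll [simp]: "fv (BAll t A) = fv_tm t \<union> {i. Suc i \<in> fv A}"
  by (auto simp: BAll_def)

lemma fv_BEx [simp]: "fv (BEx t A) = fv_tm t \<union> {i. Suc i \<in> fv A}"
  by (auto simp: BEx_def)

lemma fv_tm_Pair_tm [simp]: "fv_tm \<langle>t, u\<rangle> = fv_tm t \<union> fv_tm u"
  by (auto simp: Pair_tm_def)

lemma fv_Len_fm [simp]: "fv (Len_fm z n) = fv_tm z \<union> fv_tm n"
  by (auto simp: Len_fm_def)

lemma fv_Dec_fm [simp]: "fv (Dec_fm z k y) = fv_tm z \<union> fv_tm k \<union> fv_tm y"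
  by (auto simp: Dec_fm_def)

lemma fv_Conjs [simp]: "fv (Conjs As) = \<Union>(fv ` set As)"
  unfolding Conjs_def by (induction As) auto

lemma fv_Disjs [simp]: "fv (Disjs As) = \<Union>(fv ` set As)"
  unfolding Disjs_def by (induction As) auto

lemma fv_Ex_pow [simp]: "fv ((Ex ^^ n) A) = {i. i + n \<in> fv A}"
  by (induction n) auto

lemma fv_Earlier_fm [simp]: "fv (Earlier_fm s k x) = fv_tm s \<union> fv_tm k \<union> fv_tm x"
  by (auto simp: Earlier_fm_def)

text \<open>Without stray variables, a rule says the same under any number of quantifiers; its
  formula then depends only on the entry, the position and the sequence, the variables 0, 1 and
  2.\<close>

fun closed_rule :: "rule \<Rightarrow> bool" where
  "closed_rule (n, ps, cs, u) \<longleftrightarrow>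
    (\<forall>p\<in>set ps. fv_tm p \<subseteq> {..<n}) \<and> (\<forall>c\<in>set cs. fv c \<subseteq> {..<n}) \<and> fv_tm u \<subseteq> {..<n}"

lemma fv_Rule_fm: "closed_rule r \<Longrightarrow> fv (Rule_fm r) \<subseteq> {0, 1, 2}"
  by (cases r) (auto simp: subset_iff)

lemma fv_Derivation_fm [simp]:
  assumes "list_all closed_rule rs"
  shows "fv (Derivation_fm rs x) = fv_tm x"
proof -
  have "Suc (Suc (Suc i)) \<notin> fv (Rule_fm r)" if "r \<in> set rs" for r i
    using fv_Rule_fm[of r] that assms by (auto simp: list_all_iff)
  then have "Suc (Suc (Suc i)) \<notin> fv (Disjs (map Rule_fm rs))" for i
    by simp
  then show ?thesis
    by (simp add: Derivation_fm_def set_eq_iff del: fv_Disjs)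
qed

lemma fv_tm_g [simp]:
  "fv_tm (gVar t) = fv_tm t" "fv_tm gZero = {}" "fv_tm (gSucc t) = fv_tm t"
  "fv_tm (gAdd t u) = fv_tm t \<union> fv_tm u" "fv_tm (gMul t u) = fv_tm t \<union> fv_tm u"
  "fv_tm (gEq t u) = fv_tm t \<union> fv_tm u" "fv_tm (gNeg t) = fv_tm t"
  "fv_tm (gImp t u) = fv_tm t \<union> fv_tm u" "fv_tm (gAll t) = fv_tm t"
  by (simp_all add: gVar_def gZero_def gSucc_def gAdd_def gMul_def gEq_def gNeg_def gImp_def gAll_def)

lemma fv_syntax_fm [simp]:
  "fv (Term_fm t) = fv_tm t"
  "fv (Form_fm t) = fv_tm t"
  "fv (Num_fm n t) = fv_tm n \<union> fv_tm t"
  "fv (Lift_tm_fm c t t') = fv_tm c \<union> fv_tm t \<union> fv_tm t'"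
  "fv (Lift_fm c t t') = fv_tm c \<union> fv_tm t \<union> fv_tm t'"
  "fv (Subst_tm_fm c w t t') = fv_tm c \<union> fv_tm w \<union> fv_tm t \<union> fv_tm t'"
  "fv (Subst_fm c w t t') = fv_tm c \<union> fv_tm w \<union> fv_tm t \<union> fv_tm t'"
  "fv (Prov_fm t) = fv_tm t"
proof -
  show Term: "fv (Term_fm t) = fv_tm t" for t by (simp add: Term_fm_def)
  show Form: "fv (Form_fm t) = fv_tm t" for t by (simp add: Form_fm_def Term)
  show "fv (Num_fm n t) = fv_tm n \<union> fv_tm t" by (simp add: Num_fm_def)
  show Lift_tm: "fv (Lift_tm_fm c t t') = fv_tm c \<union> fv_tm t \<union> fv_tm t'" for c t t'
    by (simp add: Lift_tm_fm_def Let_def Un_assoc)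
  show Lift: "fv (Lift_fm c t t') = fv_tm c \<union> fv_tm t \<union> fv_tm t'" for c t t'
    by (simp add: Lift_fm_def Lift_tm Let_def Un_assoc)
  show Subst_tm: "fv (Subst_tm_fm c w t t') = fv_tm c \<union> fv_tm w \<union> fv_tm t \<union> fv_tm t'" for c w t t'
    by (simp add: Subst_tm_fm_def Let_def Un_assoc)
  show Subst: "fv (Subst_fm c w t t') = fv_tm c \<union> fv_tm w \<union> fv_tm t \<union> fv_tm t'" for c w t t'
    by (simp add: Subst_fm_def Subst_tm Lift_tm Let_def Un_assoc)
  show "fv (Prov_fm t) = fv_tm t"
    by (simp add: Prov_fm_def Term Form Lift Subst Let_def list_all_iff)
qed

section \<open>Sequences in the standard model\<close>

lemma le_NN [simp]: "le NN = (\<le>)"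
  by (auto simp: le_def fun_eq_iff intro: le_add_diff_inverse2)

lemma pr_NN [simp]: "pr NN = pair"
  by (simp add: pr_def pair_def fun_eq_iff)

lemma le_pair: "x \<le> pair x y" "y \<le> pair x y"
proof -
  have "x + y \<le> (x + y) * (x + y)" by (rule le_square)
  then show "x \<le> pair x y" "y \<le> pair x y" unfolding pair_def by linarith+
qed

lemma code_NN: "code NN z l a b \<longleftrightarrow> z = pair l (pair a b)"
  by (auto simp: code_def intro: le_pair le_trans[OF le_pair(1) le_pair(2)]
    le_trans[OF le_pair(2) le_pair(2)])

lemma beta_NN: "beta NN a b k y \<longleftrightarrow> y = a mod Suc (k * b)"
proof
  assume "beta NN a b k y"
  then obtain q where "y < Suc (k * b)" "a = y + q * Suc (k * b)"
    unfolding beta_def by auto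
  then show "y = a mod Suc (k * b)" by (simp only: mod_mult_self1 mod_less)
next
  assume y: "y = a mod Suc (k * b)"
  have "a = a div Suc (k * b) * Suc (k * b) + y"
    unfolding y by (simp only: div_mult_mod_eq)
  moreover have "a div Suc (k * b) \<le> a" by (rule div_le_dividend)
  moreover have "y < Suc (k * b)" unfolding y by simp
  ultimately show "beta NN a b k y"
    unfolding beta_def NN_simps le_NN Suc_le_eq by blast
qed

text \<open>A relation, since a list has many codes. List indices start at 0 but positions at 1,
  hence the modulus \<open>Suc (Suc i * b)\<close> for index i.\<close>

definition codes :: "nat \<Rightarrow> nat list \<Rightarrow> bool" where
  "codes s xs \<longleftrightarrow>
    (\<exists>a b. s = pair (length xs) (pair a b) \<and> (\<forall>i<length xs. xs ! i = a mod Suc (Suc i * b)))"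

lemma len_codes: "codes s xs \<Longrightarrow> len NN s n \<longleftrightarrow> n = length xs"
  using code_NN[of s n] by (auto simp: codes_def len_def code_def)

lemma dec_codes: "codes s xs \<Longrightarrow> dec NN s k y \<longleftrightarrow> 1 \<le> k \<and> k \<le> length xs \<and> xs ! (k - 1) = y"
  unfolding codes_def dec_def code_NN beta_NN by (cases k) auto

lemma code_codes: "(\<exists>l a b. code NN s l a b) \<longleftrightarrow> (\<exists>xs. codes s xs)"
proof
  assume "\<exists>l a b. code NN s l a b"
  then obtain l a b where "s = pair l (pair a b)" by (auto simp: code_NN)
  then have "codes s (map (\<lambda>i. a mod Suc (Suc i * b)) [0..<l])"
    by (auto simp: codes_def)
  then show "\<exists>xs. codes s xs" ..
next
  assume "\<exists>xs. codes s xs"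
  then show "\<exists>l a b. code NN s l a b" by (auto simp: codes_def code_NN)
qed

text \<open>Remainders of a do not exceed a, and pairing bounds its components. This is what makes
  the bounds on quantifiers over positions and terms harmless.\<close>

lemma codes_le: "codes s xs \<Longrightarrow> length xs \<le> s \<and> (\<forall>x\<in>set xs. x \<le> s)"
proof -
  assume "codes s xs"
  then obtain a b where s: "s = pair (length xs) (pair a b)"
    and xs: "\<And>i. i < length xs \<Longrightarrow> xs ! i = a mod Suc (Suc i * b)"
    by (auto simp: codes_def)
  have "a \<le> s" using le_pair(1)[of a b] le_pair(2)[of "pair a b" "length xs"] s by simp
  then have "x \<le> s" if "x \<in> set xs" for x
    using that xs by (auto simp: in_set_conv_nth) (meson le_trans mod_less_eq_dividend)
  then show ?thesis using s le_pair(1) by auto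
qed

lemma dec_le: "dec NN s k y \<Longrightarrow> k \<le> s \<and> y \<le> s"
proof -
  assume d: "dec NN s k y"
  then obtain xs where xs: "codes s xs" using code_codes unfolding dec_def by blast
  then have "k \<le> length xs" "y \<in> set xs" using d dec_codes[OF xs] by auto
  then show ?thesis using codes_le[OF xs] by auto
qed

text \<open>Goedel's beta lemma, with \<open>b\<close> a factorial so that the moduli are pairwise coprime.\<close>

lemma ex_codes: "\<exists>s. codes s xs"
proof -
  \<comment> \<open>Bounding the length makes every difference of indices divide m!; bounding the
    entries keeps them below their moduli. The inserted 0 gives the empty list a maximum.\<close>
  define m where "m = max (length xs) (Max (insert 0 (set xs)))"
  define b where "b = (fact m :: nat)"
  have cop: "coprime (Suc (Suc i * b)) (Suc (Suc j * b))" if "i < j" "j < length xs" for i j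
  proof (rule coprimeI)
    fix d
    assume d: "d dvd Suc (Suc i * b)" "d dvd Suc (Suc j * b)"
    \<comment> \<open>A divisor of a modulus, which is 1 plus a multiple of b, shares no factor with
      b.\<close>
    have cop_d: "coprime d b"
    proof (rule coprimeI)
      fix c
      assume "c dvd d" "c dvd b"
      then have "c dvd Suc i * b + 1" "c dvd Suc i * b" using d(1) by (auto intro: dvd_trans)
      then show "is_unit c" using dvd_add_right_iff by blast
    qed
    \<comment> \<open>A common divisor d divides (j - i) b, hence j - i, hence the factorial b, to
      which it is coprime.\<close>
    have "Suc (Suc j * b) - Suc (Suc i * b) = (j - i) * b"
      by (simp add: diff_mult_distrib)
    then have "d dvd (j - i) * b" using dvd_diff_nat[OF d(2,1)] by simp
    then have "d dvd j - i" using cop_d coprime_dvd_mult_left_iff by blast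
    moreover have "j - i dvd b"
      unfolding b_def by (rule dvd_fact) (use that in \<open>auto simp: m_def\<close>)
    ultimately show "is_unit d"
      using cop_d by (meson coprime_common_divisor dvd_refl dvd_trans)
  qed
  have "\<forall>i\<in>{..<length xs}. \<forall>j\<in>{..<length xs}. i \<noteq> j \<longrightarrow> coprime (Suc (Suc i * b)) (Suc (Suc j * b))"
    using cop by (metis coprime_commute lessThan_iff linorder_neqE_nat)
  then obtain a where a: "\<forall>i\<in>{..<length xs}. [a = xs ! i] (mod Suc (Suc i * b))"
    using chinese_remainder_nat[of "{..<length xs}" "\<lambda>i. Suc (Suc i * b)" "\<lambda>i. xs ! i"] by auto
  have "xs ! i = a mod Suc (Suc i * b)" if i: "i < length xs" for i
  proof -
    have "xs ! i \<le> m" unfolding m_def using i by (intro max.coboundedI2 Max_ge) auto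
    also have "m \<le> b" unfolding b_def by (rule fact_ge_self)
    finally have "xs ! i < Suc (Suc i * b)" by auto
    then show ?thesis using a i by (simp add: cong_def)
  qed
  then have "codes (pair (length xs) (pair a b)) xs" by (auto simp: codes_def)
  then show ?thesis ..
qed

lemma het_seq_codes: "codes s xs \<Longrightarrow> het_seq NN s \<longleftrightarrow> distinct xs"
proof -
  assume xs: "codes s xs"
  have "het_seq NN s \<longleftrightarrow> (\<forall>u v. u \<le> length xs \<longrightarrow> v \<le> length xs \<longrightarrow> 1 \<le> u \<longrightarrow> 1 \<le> v \<longrightarrow> u \<noteq> v \<longrightarrow>
    \<not> (\<exists>y. y \<le> s \<and> dec NN s u y \<and> dec NN s v y))"
    using xs code_codes[of s] codes_le[OF xs] by (auto simp: het_seq_def len_codes[OF xs])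
  also have "\<dots> \<longleftrightarrow> (\<forall>u v. u \<le> length xs \<longrightarrow> v \<le> length xs \<longrightarrow> 1 \<le> u \<longrightarrow> 1 \<le> v \<longrightarrow> u \<noteq> v \<longrightarrow>
    xs ! (u - 1) \<noteq> xs ! (v - 1))"
    using dec_le[of s] by (auto simp: dec_codes[OF xs])
  also have "\<dots> \<longleftrightarrow> distinct xs"
  proof
    assume *: "\<forall>u v. u \<le> length xs \<longrightarrow> v \<le> length xs \<longrightarrow> 1 \<le> u \<longrightarrow> 1 \<le> v \<longrightarrow> u \<noteq> v \<longrightarrow>
      xs ! (u - 1) \<noteq> xs ! (v - 1)"
    show "distinct xs"
      unfolding distinct_conv_nth
    proof (intro allI impI)
      fix i j
      assume "i < length xs" "j < length xs" "i \<noteq> j"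
      then show "xs ! i \<noteq> xs ! j" using *[rule_format, of "Suc i" "Suc j"] by simp
    qed
  next
    assume "distinct xs"
    then show "\<forall>u v. u \<le> length xs \<longrightarrow> v \<le> length xs \<longrightarrow> 1 \<le> u \<longrightarrow> 1 \<le> v \<longrightarrow> u \<noteq> v \<longrightarrow>
      xs ! (u - 1) \<noteq> xs ! (v - 1)"
      by (auto simp: nth_eq_iff_index_eq)
  qed
  finally show ?thesis .
qed

lemma ele_codes: "codes s xs \<Longrightarrow> ele NN x s \<longleftrightarrow> x \<in> set xs"
proof -
  assume xs: "codes s xs"
  have "ele NN x s \<longleftrightarrow> (\<exists>k\<le>length xs. 1 \<le> k \<and> xs ! (k - 1) = x)"
    using xs code_codes[of s] codes_le[OF xs] by (auto simp: ele_def len_codes[OF xs] dec_codes[OF xs])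
  also have "\<dots> \<longleftrightarrow> x \<in> set xs"
    unfolding in_set_conv_nth
    by (metis One_nat_def Suc_leI Suc_le_lessD diff_Suc_1 le_add1 plus_1_eq_Suc Suc_pred)
  finally show ?thesis .
qed

section \<open>Arithmetized inductive definitions in the standard model\<close>

inductive_set Der :: "rule list \<Rightarrow> nat set" for rs where
  rule: "(n, ps, cs, u) \<in> set rs \<Longrightarrow> (\<And>c. c \<in> set cs \<Longrightarrow> sat NN v c) \<Longrightarrow>
    (\<And>p. p \<in> set ps \<Longrightarrow> eval NN v p \<in> Der rs) \<Longrightarrow> eval NN v u \<in> Der rs"

definition follows :: "rule list \<Rightarrow> nat set \<Rightarrow> nat \<Rightarrow> bool" where
  "follows rs X y \<longleftrightarrow> (\<exists>n ps cs u v. (n, ps, cs, u) \<in> set rs \<and> y = eval NN v u \<and>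
    (\<forall>c\<in>set cs. sat NN v c) \<and> (\<forall>p\<in>set ps. eval NN v p \<in> X))"

lemma follows_mono: "follows rs X y \<Longrightarrow> X \<subseteq> Y \<Longrightarrow> follows rs Y y"
  unfolding follows_def by blast

lemma follows_Der: "follows rs (Der rs) y \<Longrightarrow> y \<in> Der rs"
  unfolding follows_def using Der.rule by blast

text \<open>Derivations are stored backwards, conclusion at the head and premises in the tail, to
  suit list recursion; \<open>rev\<close> later gives the order in which premises precede
  conclusions.\<close>

primrec derivation :: "rule list \<Rightarrow> nat list \<Rightarrow> bool" where
  "derivation rs [] \<longleftrightarrow> True"
| "derivation rs (y # ys) \<longleftrightarrow> follows rs (set ys) y \<and> derivation rs ys"

lemma derivation_append: "derivation rs xs \<Longrightarrow> derivation rs ys \<Longrightarrow> derivation rs (xs @ ys)"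
  by (induction xs) (auto intro: follows_mono)

lemma derivation_nth:
  "derivation rs ys \<Longrightarrow> i < length ys \<Longrightarrow> follows rs (set (take i (rev ys))) (rev ys ! i)"
proof (induction ys)
  case (Cons y ys)
  then show ?case by (cases "i = length ys") (simp_all add: nth_append)
qed simp

lemma Der_derivation: "y \<in> Der rs \<Longrightarrow> \<exists>ys. derivation rs (y # ys)"
proof (induction rule: Der.induct)
  case (rule n ps cs u v)
  \<comment> \<open>Derivations of the premises are concatenated one at a time; generalizing to
    lists \<open>qs\<close> of premises makes this an induction.\<close>
  have "\<exists>xs. derivation rs xs \<and> eval NN v ` set qs \<subseteq> set xs" if "set qs \<subseteq> set ps" for qs
    using that
  proof (induction qs)
    case Nil
    show ?case by (rule exI[of _ "[]"]) simp
  next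
    case (Cons q qs)
    then obtain xs where "derivation rs xs" "eval NN v ` set qs \<subseteq> set xs" by auto
    moreover obtain ys where "derivation rs (eval NN v q # ys)"
      using rule(4)[of q] Cons.prems by auto
    ultimately show ?case
      by (intro exI[of _ "(eval NN v q # ys) @ xs"] conjI derivation_append) auto
  qed
  then obtain xs where "derivation rs xs" "eval NN v ` set ps \<subseteq> set xs" by blast
  then have "derivation rs (eval NN v u # xs)"
    using rule(1,2) unfolding follows_def derivation.simps by blast
  then show ?case ..
qed

lemma sat_Ex_pow:
  "sat M e ((Ex ^^ n) A) \<longleftrightarrow> (\<exists>v. sat M (\<lambda>i. if i < n then v i else e (i - n)) A)"
proof (induction n arbitrary: e)
  case (Suc n)
  have "(\<exists>a v. sat M (\<lambda>i. if i < n then v i else case_nat a e (i - n)) A) \<longleftrightarrow>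
    (\<exists>v. sat M (\<lambda>i. if i < Suc n then v i else e (i - Suc n)) A)" (is "?L \<longleftrightarrow> ?R")
  proof
    assume ?L
    then obtain a v where "sat M (\<lambda>i. if i < n then v i else case_nat a e (i - n)) A" by blast
    \<comment> \<open>The outermost of the \<open>Suc n\<close> quantifiers binds the variable seen
      as n at the innermost level.\<close>
    moreover have "(\<lambda>i. if i < n then v i else case_nat a e (i - n)) =
      (\<lambda>i. if i < Suc n then (v(n := a)) i else e (i - Suc n))"
      by (auto simp: fun_eq_iff less_Suc_eq diff_Suc split: nat.split)
    ultimately show ?R by metis
  next
    assume ?R
    then obtain v where "sat M (\<lambda>i. if i < Suc n then v i else e (i - Suc n)) A" by blast
    moreover have "(\<lambda>i. if i < Suc n then v i else e (i - Suc n)) =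
      (\<lambda>i. if i < n then v i else case_nat (v n) e (i - n))"
      by (auto simp: fun_eq_iff less_Suc_eq diff_Suc split: nat.split)
    ultimately show ?L by metis
  qed
  then show ?case by (simp add: Suc.IH)
qed simp

lemma sat_Conjs [simp]: "sat M e (Conjs As) \<longleftrightarrow> (\<forall>A\<in>set As. sat M e A)"
  unfolding Conjs_def by (induction As) auto

lemma sat_Disjs [simp]: "sat M e (Disjs As) \<longleftrightarrow> (\<exists>A\<in>set As. sat M e A)"
  unfolding Disjs_def by (induction As) auto

lemma sat_Rule_fm:
  assumes "closed_rule (n, ps, cs, u)"
  shows "sat NN (case_nat y (case_nat k (case_nat s e))) (Rule_fm (n, ps, cs, u)) \<longleftrightarrow>
    (\<exists>v. y = eval NN v u \<and> (\<forall>c\<in>set cs. sat NN v c) \<and>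
      (\<forall>p\<in>set ps. \<exists>j<k. dec NN s j (eval NN v p)))"
proof -
  let ?e = "\<lambda>v i. if i < n then v i else case_nat y (case_nat k (case_nat s e)) (i - n)"
  have u: "eval NN (?e v) u = eval NN v u" for v
    by (rule eval_cong) (use assms in auto)
  have cs: "sat NN (?e v) c \<longleftrightarrow> sat NN v c" if "c \<in> set cs" for v c
    by (rule sat_cong) (use assms that in auto)
  have ps: "eval NN (?e v) p = eval NN v p" if "p \<in> set ps" for v p
    by (rule eval_cong) (use assms that in auto)
  have "(\<exists>j\<le>k. j < k \<and> P j) \<longleftrightarrow> (\<exists>j<k. P j)" for P
    using less_imp_le by blast
  then show ?thesis
    by (simp add: sat_Ex_pow Earlier_fm_def u cs ps Suc_le_eq ball_Un)
qed

lemma sat_rules: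
  assumes "list_all closed_rule rs"
  shows "sat NN (case_nat y (case_nat k (case_nat s e))) (Disjs (map Rule_fm rs)) \<longleftrightarrow>
    follows rs {x. \<exists>j<k. dec NN s j x} y"
proof -
  let ?S = "\<lambda>r. sat NN (case_nat y (case_nat k (case_nat s e))) (Rule_fm r)"
  have closed: "closed_rule r" if "r \<in> set rs" for r
    using assms that by (simp add: list_all_iff)
  have "sat NN (case_nat y (case_nat k (case_nat s e))) (Disjs (map Rule_fm rs)) \<longleftrightarrow>
    (\<exists>r\<in>set rs. ?S r)"
    by simp
  also have "\<dots> \<longleftrightarrow> (\<exists>n ps cs u. (n, ps, cs, u) \<in> set rs \<and> ?S (n, ps, cs, u))"
    by (simp only: Bex_def split_paired_Ex)
  also have "\<dots> \<longleftrightarrow> (\<exists>n ps cs u. (n, ps, cs, u) \<in> set rs \<and> (\<exists>v. y = eval NN v u \<and>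
    (\<forall>c\<in>set cs. sat NN v c) \<and> (\<forall>p\<in>set ps. \<exists>j<k. dec NN s j (eval NN v p))))"
    by (intro ex_cong1 conj_cong refl sat_Rule_fm closed)
  also have "\<dots> \<longleftrightarrow> follows rs {x. \<exists>j<k. dec NN s j x} y"
    unfolding follows_def mem_Collect_eq by blast
  finally show ?thesis .
qed

text \<open>If a coded derivation exists, strong induction on positions puts all its terms into
  \<open>Der rs\<close>. Conversely, a derivation is reversed and coded by the beta lemma, and
  earlier positions supply its premises.\<close>

lemma sat_Derivation_fm:
  assumes rs: "list_all closed_rule rs"
  shows "sat NN e (Derivation_fm rs x) \<longleftrightarrow> eval NN e x \<in> Der rs"
proof -
  have "sat NN e (Derivation_fm rs x) \<longleftrightarrow> (\<exists>s. (\<exists>k\<le>s. len NN s k \<and> dec NN s k (eval NN e x)) \<and>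
    (\<forall>k\<le>s. \<forall>y\<le>s. dec NN s k y \<longrightarrow> follows rs {x. \<exists>j<k. dec NN s j x} y))" (is "_ \<longleftrightarrow> ?R")
    by (simp add: Derivation_fm_def sat_rules[OF rs] del: sat_Disjs)
  also have "\<dots> \<longleftrightarrow> eval NN e x \<in> Der rs"
  proof
    assume ?R
    then obtain s k where k: "dec NN s k (eval NN e x)"
      and step: "\<And>k y. dec NN s k y \<Longrightarrow> follows rs {x. \<exists>j<k. dec NN s j x} y"
      using dec_le by blast
    have "y \<in> Der rs" if "dec NN s k y" for k y
      using that
    proof (induction k arbitrary: y rule: less_induct)
      case (less k)
      have "follows rs (Der rs) y"
        by (rule follows_mono[OF step[OF less.prems]]) (use less.IH in blast)
      then show ?case by (rule follows_Der)
    qed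
    then show "eval NN e x \<in> Der rs" using k .
  next
    assume "eval NN e x \<in> Der rs"
    then obtain ys where ys: "derivation rs (eval NN e x # ys)" using Der_derivation by blast
    define xs where "xs = rev (eval NN e x # ys)"
    obtain s where s: "codes s xs" using ex_codes by blast
    have "follows rs {x. \<exists>j<k. dec NN s j x} y" if "dec NN s k y" for k y
    proof -
      have k: "1 \<le> k" "k \<le> length xs" "y = xs ! (k - 1)" using that by (auto simp: dec_codes[OF s])
      have "follows rs (set (take (k - 1) xs)) y"
        using derivation_nth[OF ys, of "k - 1"] k by (simp add: xs_def)
      moreover have "set (take (k - 1) xs) \<subseteq> {x. \<exists>j<k. dec NN s j x}"
      proof
        fix x
        assume "x \<in> set (take (k - 1) xs)"
        then obtain j where "j < k - 1" "x = xs ! j" using k by (auto simp: in_set_conv_nth)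
        then show "x \<in> {x. \<exists>j<k. dec NN s j x}"
          using k by (intro CollectI exI[of _ "Suc j"]) (auto simp: dec_codes[OF s])
      qed
      ultimately show ?thesis by (rule follows_mono)
    qed
    moreover have "len NN s (length xs)" "dec NN s (length xs) (eval NN e x)"
      by (simp_all add: len_codes[OF s] dec_codes[OF s] xs_def nth_append)
    ultimately show ?R using dec_le by blast
  qed
  finally show ?thesis .
qed

section \<open>The arithmetized syntax in the standard model\<close>

text \<open>Parameters are given as an explicit list, entry i for \<open>Var i\<close>, so that a
  concrete rule instance is checked by evaluation.\<close>

lemma DerI:
  assumes "(n, ps, cs, u) \<in> set rs" "y = eval NN ((!) xs) u"
    "list_all (sat NN ((!) xs)) cs" "list_all (\<lambda>p. eval NN ((!) xs) p \<in> Der rs) ps"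
  shows "y \<in> Der rs"
  using Der.rule[of n ps cs u rs "(!) xs"] assms by (auto simp: list_all_iff)

lemma Der_induct [consumes 1, case_names rule]:
  assumes "x \<in> Der rs"
    and "\<And>n ps cs u v. (n, ps, cs, u) \<in> set rs \<Longrightarrow> list_all (sat NN v) cs \<Longrightarrow>
      list_all (\<lambda>p. P (eval NN v p)) ps \<Longrightarrow> P (eval NN v u)"
  shows "P x"
  using assms(1) by (induction rule: Der.induct) (simp add: assms(2) list_all_iff)

lemma eval_g [simp]:
  "eval NN e (gVar t) = pair 0 (eval NN e t)"
  "eval NN e gZero = gn_tm Zero"
  "eval NN e (gSucc t) = pair 2 (eval NN e t)"
  "eval NN e (gAdd t u) = pair 3 (pair (eval NN e t) (eval NN e u))"
  "eval NN e (gMul t u) = pair 4 (pair (eval NN e t) (eval NN e u))"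
  "eval NN e (gEq t u) = pair 5 (pair (eval NN e t) (eval NN e u))"
  "eval NN e (gNeg t) = pair 6 (eval NN e t)"
  "eval NN e (gImp t u) = pair 7 (pair (eval NN e t) (eval NN e u))"
  "eval NN e (gAll t) = pair 8 (eval NN e t)"
  by (simp_all add: gVar_def gZero_def gSucc_def gAdd_def gMul_def gEq_def gNeg_def gImp_def gAll_def)

lemma pair_eq_gn_tm:
  "pair 0 i = gn_tm A \<longleftrightarrow> A = Var i"
  "pair 2 x = gn_tm A \<longleftrightarrow> (\<exists>t. A = Succ t \<and> x = gn_tm t)"
  "pair 3 (pair x y) = gn_tm A \<longleftrightarrow> (\<exists>t u. A = t \<^bold>+ u \<and> x = gn_tm t \<and> y = gn_tm u)"
  "pair 4 (pair x y) = gn_tm A \<longleftrightarrow> (\<exists>t u. A = t \<^bold>* u \<and> x = gn_tm t \<and> y = gn_tm u)"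
  by (cases A; auto)+

lemma pair_eq_gn:
  "pair 5 (pair x y) = gn A \<longleftrightarrow> (\<exists>t u. A = (t \<^bold>= u) \<and> x = gn_tm t \<and> y = gn_tm u)"
  "pair 6 x = gn A \<longleftrightarrow> (\<exists>B. A = (\<^bold>\<not> B) \<and> x = gn B)"
  "pair 7 (pair x y) = gn A \<longleftrightarrow> (\<exists>B C. A = (B \<^bold>\<longrightarrow> C) \<and> x = gn B \<and> y = gn C)"
  "pair 8 x = gn A \<longleftrightarrow> (\<exists>B. A = (\<^bold>\<forall>B) \<and> x = gn B)"
  by (cases A; auto)+

text \<open>Codes stay folded from here on, so that \<open>pair_eq_gn_tm\<close> and
  \<open>pair_eq_gn\<close> can read off the outermost constructor from the tag.\<close>

lemmas [simp del] = gn_tm.simps gn.simps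

text \<open>A name for the rule list inside \<open>Term_fm\<close>, so that its generated set can be
  studied apart from the formula. The other rule lists below serve the same end.\<close>

definition term_rules :: "rule list" where
  "term_rules =
    [(1, [], [], gVar (Var 0)),
     (0, [], [], gZero),
     (1, [Var 0], [], gSucc (Var 0)),
     (2, [Var 0, Var 1], [], gAdd (Var 0) (Var 1)),
     (2, [Var 0, Var 1], [], gMul (Var 0) (Var 1))]"

lemma Der_term_rules: "x \<in> Der term_rules \<longleftrightarrow> (\<exists>t. x = gn_tm t)"
proof
  assume "x \<in> Der term_rules"
  then show "\<exists>t. x = gn_tm t"
    by (induction rule: Der_induct) (auto simp: term_rules_def pair_eq_gn_tm)
next
  have "gn_tm t \<in> Der term_rules" for t
  proof (induction t)
    case (Var i)
    show ?case
      by (rule DerI[of 1 "[]" "[]"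
            "gVar (Var 0)" _ _ "[i]"]) (simp_all add: term_rules_def gn_tm.simps)
  next
    case Zero
    show ?case
      by (rule DerI[of 0 "[]" "[]" gZero _ _ "[]"]) (simp_all add: term_rules_def)
  next
    case (Succ t)
    then show ?case
      by (intro DerI[of 1 "[Var 0]" "[]" "gSucc (Var 0)" _ _ "[gn_tm t]"])
        (simp_all add: term_rules_def gn_tm.simps)
  next
    case (Add t u)
    then show ?case
      by (intro DerI[of 2 "[Var 0, Var 1]" "[]" "gAdd (Var 0) (Var 1)" _ _ "[gn_tm t, gn_tm u]"])
        (simp_all add: term_rules_def gn_tm.simps)
  next
    case (Mul t u)
    then show ?case
      by (intro DerI[of 2 "[Var 0, Var 1]" "[]" "gMul (Var 0) (Var 1)" _ _ "[gn_tm t, gn_tm u]"])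
        (simp_all add: term_rules_def gn_tm.simps)
  qed
  then show "\<exists>t. x = gn_tm t \<Longrightarrow> x \<in> Der term_rules" by blast
qed

lemma sat_Term_fm [simp]: "sat NN e (Term_fm t) \<longleftrightarrow> (\<exists>t'. eval NN e t = gn_tm t')"
  unfolding Der_term_rules[symmetric] Term_fm_def
  by (subst sat_Derivation_fm) (simp_all add: term_rules_def)

definition form_rules :: "rule list" where
  "form_rules =
    [(2, [], [Term_fm (Var 0), Term_fm (Var 1)], gEq (Var 0) (Var 1)),
     (1, [Var 0], [], gNeg (Var 0)),
     (2, [Var 0, Var 1], [], gImp (Var 0) (Var 1)),
     (1, [Var 0], [], gAll (Var 0))]"

lemma Der_form_rules: "x \<in> Der form_rules \<longleftrightarrow> (\<exists>A. x = gn A)"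
proof
  assume "x \<in> Der form_rules"
  then show "\<exists>A. x = gn A"
    by (induction rule: Der_induct) (auto simp: form_rules_def pair_eq_gn)
next
  have "gn A \<in> Der form_rules" for A
  proof (induction A)
    case (Eq t u)
    show ?case
      by (rule DerI[of 2 "[]" "[Term_fm (Var 0), Term_fm (Var 1)]" "gEq (Var 0) (Var 1)"
            _ _ "[gn_tm t, gn_tm u]"]) (simp_all add: form_rules_def gn.simps)
  next
    case (Neg A)
    then show ?case
      by (intro DerI[of 1 "[Var 0]" "[]" "gNeg (Var 0)" _ _ "[gn A]"])
        (simp_all add: form_rules_def gn.simps)
  next
    case (Imp A B)
    then show ?case
      by (intro DerI[of 2 "[Var 0, Var 1]" "[]" "gImp (Var 0) (Var 1)" _ _ "[gn A, gn B]"])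
        (simp_all add: form_rules_def gn.simps)
  next
    case (All A)
    then show ?case
      by (intro DerI[of 1 "[Var 0]" "[]" "gAll (Var 0)" _ _ "[gn A]"])
        (simp_all add: form_rules_def gn.simps)
  qed
  then show "\<exists>A. x = gn A \<Longrightarrow> x \<in> Der form_rules" by blast
qed

lemma sat_Form_fm [simp]: "sat NN e (Form_fm t) \<longleftrightarrow> (\<exists>A. eval NN e t = gn A)"
  unfolding Der_form_rules[symmetric] Form_fm_def
  by (subst sat_Derivation_fm) (simp_all add: form_rules_def)

definition num_rules :: "rule list" where
  "num_rules =
    [(0, [], [], \<langle>Zero, gZero\<rangle>),
     (2, [\<langle>Var 0, Var 1\<rangle>], [], \<langle>Succ (Var 0), gSucc (Var 1)\<rangle>)]"

lemma Der_num_rules: "pair n x \<in> Der num_rules \<longleftrightarrow> x = gn_tm (num n)"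
proof
  have "\<exists>n. y = pair n (gn_tm (num n))" if "y \<in> Der num_rules" for y
    using that
    by (induction rule: Der_induct) (auto simp: num_rules_def gn_tm.simps(3))
  then show "pair n x \<in> Der num_rules \<Longrightarrow> x = gn_tm (num n)" by fastforce
next
  have "pair n (gn_tm (num n)) \<in> Der num_rules"
  proof (induction n)
    case 0
    show ?case
      by (rule DerI[of 0 "[]" "[]" "\<langle>Zero, gZero\<rangle>" _ _ "[]"]) (simp_all add: num_rules_def)
  next
    case (Suc n)
    then show ?case
      by (intro DerI[of 2 "[\<langle>Var 0, Var 1\<rangle>]" "[]" "\<langle>Succ (Var 0), gSucc (Var 1)\<rangle>" _ _
            "[n, gn_tm (num n)]"])
        (simp_all add: num_rules_def gn_tm.simps)
  qed
  then show "x = gn_tm (num n) \<Longrightarrow> pair n x \<in> Der num_rules" by blast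
qed

lemma sat_Num_fm [simp]: "sat NN e (Num_fm n t) \<longleftrightarrow> eval NN e t = gn_tm (num (eval NN e n))"
  unfolding Der_num_rules[symmetric] Num_fm_def
  by (subst sat_Derivation_fm) (simp_all add: num_rules_def)

section \<open>Graphs of lifting and substitution\<close>

definition lift_tm_rules :: "rule list" where
  "lift_tm_rules =
    (let j = (\<lambda>c t t'. \<langle>c, \<langle>t, t'\<rangle>\<rangle>); c0 = Var 0; i = Var 1;
         a = Var 1; a' = Var 2; b = Var 3; b' = Var 4 in
      [(2, [], [i \<^bold>< c0], j c0 (gVar i) (gVar i)),
       (2, [], [c0 \<^bold>\<le> i], j c0 (gVar i) (gVar (Succ i))),
       (1, [], [], j c0 gZero gZero),
       (3, [j c0 a a'], [], j c0 (gSucc a) (gSucc a')),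
       (5, [j c0 a a', j c0 b b'], [], j c0 (gAdd a b) (gAdd a' b')),
       (5, [j c0 a a', j c0 b b'], [], j c0 (gMul a b) (gMul a' b'))])"

text \<open>Defined for arbitrary numbers because the formula is; its value is determined below only
  when the second argument is the code of a term.\<close>

definition liftT :: "nat \<Rightarrow> nat \<Rightarrow> nat \<Rightarrow> bool" where
  "liftT c x x' \<longleftrightarrow> pair c (pair x x') \<in> Der lift_tm_rules"

lemma sat_Lift_tm_fm [simp]:
  "sat NN e (Lift_tm_fm c t t') \<longleftrightarrow> liftT (eval NN e c) (eval NN e t) (eval NN e t')"
  unfolding Lift_tm_fm_def liftT_def Let_def
  by (subst sat_Derivation_fm) (simp_all add: lift_tm_rules_def Let_def)

lemma liftT_gn_tm [simp]: "liftT c (gn_tm t) x \<longleftrightarrow> x = gn_tm (lift_tm c t)"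
proof
  \<comment> \<open>Stated for an arbitrary derivable number \<open>y\<close>, so that rule
    induction applies; injectivity of \<open>pair\<close> recovers the triple.\<close>
  have "\<forall>c t x. y = pair c (pair (gn_tm t) x) \<longrightarrow> x = gn_tm (lift_tm c t)"
    if "y \<in> Der lift_tm_rules" for y
    using that
    by (induction rule: Der_induct)
      (auto simp: lift_tm_rules_def Let_def pair_eq_gn_tm gn_tm.simps(1,3-5))
  then show "liftT c (gn_tm t) x \<Longrightarrow> x = gn_tm (lift_tm c t)" by (simp add: liftT_def)
next
  have "liftT c (gn_tm t) (gn_tm (lift_tm c t))"
  proof (induction t)
    case (Var i)
    show ?case
    proof (cases "i < c")
      case True
      then show ?thesis unfolding liftT_def
        by (intro DerI[of 2 "[]" "[Var 1 \<^bold>< Var 0]"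
            "\<langle>Var 0, \<langle>gVar (Var 1), gVar (Var 1)\<rangle>\<rangle>" _ _ "[c, i]"])
          (simp_all add: lift_tm_rules_def gn_tm.simps Let_def)
    next
      case False
      then show ?thesis unfolding liftT_def
        by (intro DerI[of 2 "[]" "[Var 0 \<^bold>\<le> Var 1]"
            "\<langle>Var 0, \<langle>gVar (Var 1), gVar (Succ (Var 1))\<rangle>\<rangle>" _ _ "[c, i]"])
          (simp_all add: lift_tm_rules_def gn_tm.simps Let_def)
    qed
  next
    case Zero
    show ?case unfolding liftT_def
      by (rule DerI[of 1 "[]" "[]" "\<langle>Var 0, \<langle>gZero, gZero\<rangle>\<rangle>" _ _ "[c]"])
        (simp_all add: lift_tm_rules_def Let_def)
  next
    case (Succ t)
    then show ?case unfolding liftT_def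
      by (intro DerI[of 3 "[\<langle>Var 0, \<langle>Var 1, Var 2\<rangle>\<rangle>]" "[]"
            "\<langle>Var 0, \<langle>gSucc (Var 1), gSucc (Var 2)\<rangle>\<rangle>" _ _
            "[c, gn_tm t, gn_tm (lift_tm c t)]"])
        (simp_all add: lift_tm_rules_def gn_tm.simps Let_def)
  next
    case (Add t u)
    then show ?case unfolding liftT_def
      by (intro DerI[of 5 "[\<langle>Var 0, \<langle>Var 1, Var 2\<rangle>\<rangle>, \<langle>Var 0, \<langle>Var 3, Var 4\<rangle>\<rangle>]" "[]"
            "\<langle>Var 0, \<langle>gAdd (Var 1) (Var 3), gAdd (Var 2) (Var 4)\<rangle>\<rangle>" _ _
            "[c, gn_tm t, gn_tm (lift_tm c t), gn_tm u, gn_tm (lift_tm c u)]"])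
        (simp_all add: lift_tm_rules_def gn_tm.simps Let_def)
  next
    case (Mul t u)
    then show ?case unfolding liftT_def
      by (intro DerI[of 5 "[\<langle>Var 0, \<langle>Var 1, Var 2\<rangle>\<rangle>, \<langle>Var 0, \<langle>Var 3, Var 4\<rangle>\<rangle>]" "[]"
            "\<langle>Var 0, \<langle>gMul (Var 1) (Var 3), gMul (Var 2) (Var 4)\<rangle>\<rangle>" _ _
            "[c, gn_tm t, gn_tm (lift_tm c t), gn_tm u, gn_tm (lift_tm c u)]"])
        (simp_all add: lift_tm_rules_def gn_tm.simps Let_def)
  qed
  then show "x = gn_tm (lift_tm c t) \<Longrightarrow> liftT c (gn_tm t) x" by simp
qed

definition lift_rules :: "rule list" where
  "lift_rules =
    (let j = (\<lambda>c x x'. \<langle>c, \<langle>x, x'\<rangle>\<rangle>); c0 = Var 0;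
         a = Var 1; a' = Var 2; b = Var 3; b' = Var 4 in
      [(5, [], [Lift_tm_fm c0 a a', Lift_tm_fm c0 b b'], j c0 (gEq a b) (gEq a' b')),
       (3, [j c0 a a'], [], j c0 (gNeg a) (gNeg a')),
       (5, [j c0 a a', j c0 b b'], [], j c0 (gImp a b) (gImp a' b')),
       (3, [j (Succ c0) a a'], [], j c0 (gAll a) (gAll a'))])"

definition liftF :: "nat \<Rightarrow> nat \<Rightarrow> nat \<Rightarrow> bool" where
  "liftF c x x' \<longleftrightarrow> pair c (pair x x') \<in> Der lift_rules"

lemma sat_Lift_fm [simp]:
  "sat NN e (Lift_fm c t t') \<longleftrightarrow> liftF (eval NN e c) (eval NN e t) (eval NN e t')"
  unfolding Lift_fm_def liftF_def Let_def
  by (subst sat_Derivation_fm) (simp_all add: lift_rules_def Let_def)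

lemma liftF_gn [simp]: "liftF c (gn A) x \<longleftrightarrow> x = gn (lift c A)"
proof
  have "\<forall>c A x. y = pair c (pair (gn A) x) \<longrightarrow> x = gn (lift c A)"
    if "y \<in> Der lift_rules" for y
    using that
    by (induction rule: Der_induct)
      (auto simp: lift_rules_def Let_def pair_eq_gn gn.simps)
  then show "liftF c (gn A) x \<Longrightarrow> x = gn (lift c A)" by (simp add: liftF_def)
next
  have "liftF c (gn A) (gn (lift c A))"
  proof (induction A arbitrary: c)
    case (Eq t u)
    show ?case unfolding liftF_def
      by (rule DerI[of 5 "[]"
            "[Lift_tm_fm (Var 0) (Var 1) (Var 2), Lift_tm_fm (Var 0) (Var 3) (Var 4)]"
            "\<langle>Var 0, \<langle>gEq (Var 1) (Var 3), gEq (Var 2) (Var 4)\<rangle>\<rangle>" _ _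
            "[c, gn_tm t, gn_tm (lift_tm c t), gn_tm u, gn_tm (lift_tm c u)]"])
        (simp_all add: lift_rules_def gn.simps Let_def)
  next
    case (Neg A)
    then show ?case unfolding liftF_def
      by (intro DerI[of 3 "[\<langle>Var 0, \<langle>Var 1, Var 2\<rangle>\<rangle>]" "[]"
            "\<langle>Var 0, \<langle>gNeg (Var 1), gNeg (Var 2)\<rangle>\<rangle>" _ _
            "[c, gn A, gn (lift c A)]"])
        (simp_all add: lift_rules_def gn.simps Let_def)
  next
    case (Imp A B)
    then show ?case unfolding liftF_def
      by (intro DerI[of 5 "[\<langle>Var 0, \<langle>Var 1, Var 2\<rangle>\<rangle>, \<langle>Var 0, \<langle>Var 3, Var 4\<rangle>\<rangle>]" "[]"
            "\<langle>Var 0, \<langle>gImp (Var 1) (Var 3), gImp (Var 2) (Var 4)\<rangle>\<rangle>" _ _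
            "[c, gn A, gn (lift c A), gn B, gn (lift c B)]"])
        (simp_all add: lift_rules_def gn.simps Let_def)
  next
    case (All A)
    show ?case using All[of "Suc c"] unfolding liftF_def
      by (intro DerI[of 3 "[\<langle>Succ (Var 0), \<langle>Var 1, Var 2\<rangle>\<rangle>]" "[]"
            "\<langle>Var 0, \<langle>gAll (Var 1), gAll (Var 2)\<rangle>\<rangle>" _ _
            "[c, gn A, gn (lift (Suc c) A)]"])
        (simp_all add: lift_rules_def gn.simps Let_def)
  qed
  then show "x = gn (lift c A) \<Longrightarrow> liftF c (gn A) x" by simp
qed

definition subst_tm_rules :: "rule list" where
  "subst_tm_rules =
    (let j = (\<lambda>c w t t'. \<langle>c, \<langle>w, \<langle>t, t'\<rangle>\<rangle>\<rangle>); c0 = Var 0; w0 = Var 1; i = Var 2;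
         a = Var 2; a' = Var 3; b = Var 4; b' = Var 5 in
      [(3, [], [i \<^bold>< c0], j c0 w0 (gVar i) (gVar i)),
       (2, [], [], j c0 w0 (gVar c0) w0),
       (3, [], [c0 \<^bold>\<le> i], j c0 w0 (gVar (Succ i)) (gVar i)),
       (2, [], [], j c0 w0 gZero gZero),
       (4, [j c0 w0 a a'], [], j c0 w0 (gSucc a) (gSucc a')),
       (6, [j c0 w0 a a', j c0 w0 b b'], [], j c0 w0 (gAdd a b) (gAdd a' b')),
       (6, [j c0 w0 a a', j c0 w0 b b'], [], j c0 w0 (gMul a b) (gMul a' b'))])"

definition substT :: "nat \<Rightarrow> nat \<Rightarrow> nat \<Rightarrow> nat \<Rightarrow> bool" where
  "substT c w x x' \<longleftrightarrow> pair c (pair w (pair x x')) \<in> Der subst_tm_rules"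

lemma sat_Subst_tm_fm [simp]:
  "sat NN e (Subst_tm_fm c w t t') \<longleftrightarrow>
    substT (eval NN e c) (eval NN e w) (eval NN e t) (eval NN e t')"
  unfolding Subst_tm_fm_def substT_def Let_def
  by (subst sat_Derivation_fm) (simp_all add: subst_tm_rules_def Let_def)

lemma substT_gn_tm [simp]:
  "substT c (gn_tm w) (gn_tm t) x \<longleftrightarrow> x = gn_tm (subst_tm c w t)"
proof
  have "\<forall>c w t x. y = pair c (pair (gn_tm w) (pair (gn_tm t) x)) \<longrightarrow> x = gn_tm (subst_tm c w t)"
    if "y \<in> Der subst_tm_rules" for y
    using that
    by (induction rule: Der_induct)
      (auto simp: subst_tm_rules_def Let_def pair_eq_gn_tm gn_tm.simps(1,3-5))
  then show "substT c (gn_tm w) (gn_tm t) x \<Longrightarrow> x = gn_tm (subst_tm c w t)"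
    by (simp add: substT_def)
next
  have "substT c (gn_tm w) (gn_tm t) (gn_tm (subst_tm c w t))"
  proof (induction t)
    case (Var i)
    \<comment> \<open>One case per variable rule. Above c the index is written as a successor, since
      the rule avoids predecessors.\<close>
    consider "i < c" | "i = c" | k where "i = Suc k" "c \<le> k"
      by (cases i) (auto simp: less_Suc_eq_le, linarith)
    then show ?case
    proof cases
      case 1
      then show ?thesis unfolding substT_def
        by (intro DerI[of 3 "[]" "[Var 2 \<^bold>< Var 0]"
              "\<langle>Var 0, \<langle>Var 1, \<langle>gVar (Var 2), gVar (Var 2)\<rangle>\<rangle>\<rangle>" _ _ "[c, gn_tm w, i]"])
          (simp_all add: subst_tm_rules_def gn_tm.simps Let_def)
    next
      case 2
      then show ?thesis unfolding substT_def
        by (intro DerI[of 2 "[]" "[]"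
              "\<langle>Var 0, \<langle>Var 1, \<langle>gVar (Var 0), Var 1\<rangle>\<rangle>\<rangle>" _ _ "[c, gn_tm w]"])
          (simp_all add: subst_tm_rules_def gn_tm.simps Let_def)
    next
      case 3
      then show ?thesis unfolding substT_def
        by (intro DerI[of 3 "[]" "[Var 0 \<^bold>\<le> Var 2]"
              "\<langle>Var 0, \<langle>Var 1, \<langle>gVar (Succ (Var 2)), gVar (Var 2)\<rangle>\<rangle>\<rangle>" _ _ "[c, gn_tm w, k]"])
          (simp_all add: subst_tm_rules_def gn_tm.simps Let_def)
    qed
  next
    case Zero
    show ?case unfolding substT_def
      by (rule DerI[of 2 "[]" "[]" "\<langle>Var 0, \<langle>Var 1, \<langle>gZero, gZero\<rangle>\<rangle>\<rangle>" _ _ "[c, gn_tm w]"])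
        (simp_all add: subst_tm_rules_def Let_def)
  next
    case (Succ t)
    then show ?case unfolding substT_def
      by (intro DerI[of 4 "[\<langle>Var 0, \<langle>Var 1, \<langle>Var 2, Var 3\<rangle>\<rangle>\<rangle>]" "[]"
            "\<langle>Var 0, \<langle>Var 1, \<langle>gSucc (Var 2), gSucc (Var 3)\<rangle>\<rangle>\<rangle>" _ _
            "[c, gn_tm w, gn_tm t, gn_tm (subst_tm c w t)]"])
        (simp_all add: subst_tm_rules_def gn_tm.simps Let_def)
  next
    case (Add t u)
    then show ?case unfolding substT_def
      by (intro DerI[of 6 "[\<langle>Var 0, \<langle>Var 1, \<langle>Var 2, Var 3\<rangle>\<rangle>\<rangle>, \<langle>Var 0, \<langle>Var 1, \<langle>Var 4, Var 5\<rangle>\<rangle>\<rangle>]"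
            "[]"
            "\<langle>Var 0, \<langle>Var 1, \<langle>gAdd (Var 2) (Var 4), gAdd (Var 3) (Var 5)\<rangle>\<rangle>\<rangle>" _ _
            "[c, gn_tm w, gn_tm t, gn_tm (subst_tm c w t), gn_tm u, gn_tm (subst_tm c w u)]"])
        (simp_all add: subst_tm_rules_def gn_tm.simps Let_def)
  next
    case (Mul t u)
    then show ?case unfolding substT_def
      by (intro DerI[of 6 "[\<langle>Var 0, \<langle>Var 1, \<langle>Var 2, Var 3\<rangle>\<rangle>\<rangle>, \<langle>Var 0, \<langle>Var 1, \<langle>Var 4, Var 5\<rangle>\<rangle>\<rangle>]"
            "[]"
            "\<langle>Var 0, \<langle>Var 1, \<langle>gMul (Var 2) (Var 4), gMul (Var 3) (Var 5)\<rangle>\<rangle>\<rangle>" _ _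
            "[c, gn_tm w, gn_tm t, gn_tm (subst_tm c w t), gn_tm u, gn_tm (subst_tm c w u)]"])
        (simp_all add: subst_tm_rules_def gn_tm.simps Let_def)
  qed
  then show "x = gn_tm (subst_tm c w t) \<Longrightarrow> substT c (gn_tm w) (gn_tm t) x" by simp
qed

definition subst_rules :: "rule list" where
  "subst_rules =
    (let j = (\<lambda>c w x x'. \<langle>c, \<langle>w, \<langle>x, x'\<rangle>\<rangle>\<rangle>); c0 = Var 0; w0 = Var 1;
         a = Var 2; a' = Var 3; b = Var 4; b' = Var 5; w1 = Var 4 in
      [(6, [], [Subst_tm_fm c0 w0 a a', Subst_tm_fm c0 w0 b b'],
         j c0 w0 (gEq a b) (gEq a' b')),
       (4, [j c0 w0 a a'], [], j c0 w0 (gNeg a) (gNeg a')),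
       (6, [j c0 w0 a a', j c0 w0 b b'], [], j c0 w0 (gImp a b) (gImp a' b')),
       (5, [j (Succ c0) w1 a a'], [Lift_tm_fm Zero w0 w1], j c0 w0 (gAll a) (gAll a'))])"

definition substF :: "nat \<Rightarrow> nat \<Rightarrow> nat \<Rightarrow> nat \<Rightarrow> bool" where
  "substF c w x x' \<longleftrightarrow> pair c (pair w (pair x x')) \<in> Der subst_rules"

lemma sat_Subst_fm [simp]:
  "sat NN e (Subst_fm c w t t') \<longleftrightarrow>
    substF (eval NN e c) (eval NN e w) (eval NN e t) (eval NN e t')"
  unfolding Subst_fm_def substF_def Let_def
  by (subst sat_Derivation_fm) (simp_all add: subst_rules_def Let_def)

lemma substF_gn [simp]:
  "substF c (gn_tm w) (gn A) x \<longleftrightarrow> x = gn (subst c w A)"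
proof
  \<comment> \<open>Both \<open>c\<close> and \<open>w\<close> are quantified, as the rule for
    quantifiers increments the one and lifts the other.\<close>
  have "\<forall>c w A x. y = pair c (pair (gn_tm w) (pair (gn A) x)) \<longrightarrow> x = gn (subst c w A)"
    if "y \<in> Der subst_rules" for y
    using that
    by (induction rule: Der_induct)
      (auto simp: subst_rules_def Let_def pair_eq_gn gn.simps)
  then show "substF c (gn_tm w) (gn A) x \<Longrightarrow> x = gn (subst c w A)"
    by (simp add: substF_def)
next
  have "substF c (gn_tm w) (gn A) (gn (subst c w A))"
  proof (induction A arbitrary: c w)
    case (Eq t u)
    show ?case unfolding substF_def
      by (rule DerI[of 6 "[]"
            "[Subst_tm_fm (Var 0) (Var 1) (Var 2) (Var 3), Subst_tm_fm (Var 0) (Var 1) (Var 4) (Var 5)]"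
            "\<langle>Var 0, \<langle>Var 1, \<langle>gEq (Var 2) (Var 4), gEq (Var 3) (Var 5)\<rangle>\<rangle>\<rangle>" _ _
            "[c, gn_tm w, gn_tm t, gn_tm (subst_tm c w t), gn_tm u, gn_tm (subst_tm c w u)]"])
        (simp_all add: subst_rules_def gn.simps Let_def)
  next
    case (Neg A)
    then show ?case unfolding substF_def
      by (intro DerI[of 4 "[\<langle>Var 0, \<langle>Var 1, \<langle>Var 2, Var 3\<rangle>\<rangle>\<rangle>]" "[]"
            "\<langle>Var 0, \<langle>Var 1, \<langle>gNeg (Var 2), gNeg (Var 3)\<rangle>\<rangle>\<rangle>" _ _
            "[c, gn_tm w, gn A, gn (subst c w A)]"])
        (simp_all add: subst_rules_def gn.simps Let_def)
  next
    case (Imp A B)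
    then show ?case unfolding substF_def
      by (intro DerI[of 6 "[\<langle>Var 0, \<langle>Var 1, \<langle>Var 2, Var 3\<rangle>\<rangle>\<rangle>, \<langle>Var 0, \<langle>Var 1, \<langle>Var 4, Var 5\<rangle>\<rangle>\<rangle>]"
            "[]"
            "\<langle>Var 0, \<langle>Var 1, \<langle>gImp (Var 2) (Var 4), gImp (Var 3) (Var 5)\<rangle>\<rangle>\<rangle>" _ _
            "[c, gn_tm w, gn A, gn (subst c w A), gn B, gn (subst c w B)]"])
        (simp_all add: subst_rules_def gn.simps Let_def)
  next
    case (All A)
    show ?case using All[of "Suc c" "lift_tm 0 w"] unfolding substF_def
      by (intro DerI[of 5 "[\<langle>Succ (Var 0), \<langle>Var 4, \<langle>Var 2, Var 3\<rangle>\<rangle>\<rangle>]"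
            "[Lift_tm_fm Zero (Var 1) (Var 4)]"
            "\<langle>Var 0, \<langle>Var 1, \<langle>gAll (Var 2), gAll (Var 3)\<rangle>\<rangle>\<rangle>" _ _
            "[c, gn_tm w, gn A, gn (subst (Suc c) (lift_tm 0 w) A), gn_tm (lift_tm 0 w)]"])
        (simp_all add: subst_rules_def gn.simps Let_def)
  qed
  then show "x = gn (subst c w A) \<Longrightarrow> substF c (gn_tm w) (gn A) x" by simp
qed

section \<open>Coded proofs and provability\<close>

definition prov_rules :: "rule list" where
  "prov_rules =
    (let a = Var 0; b = Var 1; c = Var 2; w = Var 1; a0 = Var 1; a1 = Var 2; a2 = Var 3 in
      map (\<lambda>A. (0, [], [], num (gn A))) basic_axioms @
       [(4, [], [Form_fm a, Subst_fm Zero gZero a a0, Lift_fm (num 1) a a1,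
                 Subst_fm Zero (num (gn_tm (Succ (Var 0)))) a1 a2],
          gImp a0 (gImp (gAll (gImp a a2)) (gAll a))),
        (2, [], [Form_fm a, Form_fm b], gImp a (gImp b a)),
        (3, [], [Form_fm a, Form_fm b, Form_fm c],
          gImp (gImp a (gImp b c)) (gImp (gImp a b) (gImp a c))),
        (2, [], [Form_fm a, Form_fm b], gImp (gImp (gNeg a) (gNeg b)) (gImp b a)),
        (3, [], [Form_fm a, Term_fm w, Subst_fm Zero w a c], gImp (gAll a) c),
        (2, [], [Form_fm a, Form_fm b], gImp (gAll (gImp a b)) (gImp (gAll a) (gAll b))),
        (2, [], [Form_fm a, Lift_fm Zero a b], gImp a (gAll b)),
        (2, [gImp a b, a], [], b),
        (1, [a], [], gAll a)])"

text \<open>The side conditions \<open>Form_fm\<close> and \<open>Term_fm\<close> force the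
  parameters of axioms to be codes; the graph formulas then have unique values. For modus ponens,
  the tag 7 and injectivity of \<open>gn\<close> recover the implication.\<close>

lemma Der_prov_rules_PA: "x \<in> Der prov_rules \<Longrightarrow> \<exists>A. x = gn A \<and> (\<turnstile> A)"
proof (induction rule: Der_induct)
  case (rule n ps cs u v)
  then show ?case
    unfolding prov_rules_def Let_def set_append Un_iff
  proof (elim disjE)
    assume "(n, ps, cs, u) \<in> set (map (\<lambda>A. (0, [], [], num (gn A))) basic_axioms)"
    then show ?thesis by (auto intro: PA.basic)
  qed (auto simp: gn.simps(2-4)[symmetric] pair_eq_gn;
      (simp add: PA.induction[simplified] PA.K PA.S PA.contra PA.inst PA.dist PA.vacuous PA.Gen
      | blast intro: PA.MP))
qed

lemma PA_Der_prov_rules: "\<turnstile> A \<Longrightarrow> gn A \<in> Der prov_rules"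
proof (induction rule: PA.induct)
  case (basic A)
  then show ?case
    by (intro DerI[of 0 "[]" "[]" "num (gn A)" _ _ "[]"]) (auto simp: prov_rules_def Let_def)
next
  case (induction A)
  let ?A1 = "lift 1 A"
  show ?case
    by (rule DerI[of 4 "[]" "[Form_fm (Var 0), Subst_fm Zero gZero (Var 0) (Var 1),
          Lift_fm (num 1) (Var 0) (Var 2), Subst_fm Zero (num (gn_tm (Succ (Var 0)))) (Var 2) (Var 3)]"
          "gImp (Var 1) (gImp (gAll (gImp (Var 0) (Var 3))) (gAll (Var 0)))" _ _
          "[gn A, gn (subst 0 Zero A), gn ?A1, gn (subst 0 (Succ (Var 0)) ?A1)]"])
      (simp_all add: prov_rules_def Let_def gn.simps)
next
  case (K A B)
  show ?case
    by (rule DerI[of 2 "[]" "[Form_fm (Var 0), Form_fm (Var 1)]"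
          "gImp (Var 0) (gImp (Var 1) (Var 0))" _ _ "[gn A, gn B]"])
      (simp_all add: prov_rules_def Let_def gn.simps)
next
  case (S A B C)
  show ?case
    by (rule DerI[of 3 "[]" "[Form_fm (Var 0), Form_fm (Var 1), Form_fm (Var 2)]"
          "gImp (gImp (Var 0) (gImp (Var 1) (Var 2)))
            (gImp (gImp (Var 0) (Var 1)) (gImp (Var 0) (Var 2)))" _ _ "[gn A, gn B, gn C]"])
      (simp_all add: prov_rules_def Let_def gn.simps)
next
  case (contra A B)
  show ?case
    by (rule DerI[of 2 "[]" "[Form_fm (Var 0), Form_fm (Var 1)]"
          "gImp (gImp (gNeg (Var 0)) (gNeg (Var 1))) (gImp (Var 1) (Var 0))" _ _ "[gn A, gn B]"])
      (simp_all add: prov_rules_def Let_def gn.simps)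
next
  case (inst A w)
  show ?case
    by (rule DerI[of 3 "[]"
            "[Form_fm (Var 0), Term_fm (Var 1), Subst_fm Zero (Var 1) (Var 0) (Var 2)]"
          "gImp (gAll (Var 0)) (Var 2)" _ _ "[gn A, gn_tm w, gn (subst 0 w A)]"])
      (simp_all add: prov_rules_def Let_def gn.simps)
next
  case (dist A B)
  show ?case
    by (rule DerI[of 2 "[]" "[Form_fm (Var 0), Form_fm (Var 1)]"
          "gImp (gAll (gImp (Var 0) (Var 1))) (gImp (gAll (Var 0)) (gAll (Var 1)))" _ _
          "[gn A, gn B]"])
      (simp_all add: prov_rules_def Let_def gn.simps)
next
  case (vacuous A)
  show ?case
    by (rule DerI[of 2 "[]" "[Form_fm (Var 0), Lift_fm Zero (Var 0) (Var 1)]"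
          "gImp (Var 0) (gAll (Var 1))" _ _ "[gn A, gn (lift 0 A)]"])
      (simp_all add: prov_rules_def Let_def gn.simps)
next
  case (MP A B)
  then show ?case
    by (intro DerI[of 2 "[gImp (Var 0) (Var 1), Var 0]" "[]" "Var 1" _ _ "[gn A, gn B]"])
      (simp_all add: prov_rules_def Let_def gn.simps)
next
  case (Gen A)
  then show ?case
    by (intro DerI[of 1 "[Var 0]" "[]" "gAll (Var 0)" _ _ "[gn A]"])
      (simp_all add: prov_rules_def Let_def gn.simps)
qed

lemma sat_Prov_fm [simp]: "sat NN e (Prov_fm t) \<longleftrightarrow> (\<exists>A. eval NN e t = gn A \<and> (\<turnstile> A))"
proof -
  have "sat NN e (Prov_fm t) \<longleftrightarrow> eval NN e t \<in> Der prov_rules"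
    unfolding Prov_fm_def Let_def
    by (subst sat_Derivation_fm) (simp_all add: prov_rules_def Let_def list_all_iff)
  then show ?thesis using Der_prov_rules_PA PA_Der_prov_rules by auto
qed

lemma sat_Prov_neg_dot_fm [simp]:
  "sat NN e (Prov_neg_dot_fm A x t) \<longleftrightarrow> (\<turnstile> \<^bold>\<not> subst x (num (eval NN e t)) A)"
  by (auto simp: Prov_neg_dot_fm_def pair_eq_gn)

section \<open>Arithmetic in models of Peano arithmetic\<close>

locale PA_model =
  fixes M :: "'a interp"
  assumes sat_PA: "\<turnstile> A \<Longrightarrow> sat M e A"
begin

abbreviation "Z \<equiv> zero M"
abbreviation "S \<equiv> succ M"
abbreviation plus (infixl "\<oplus>" 65) where "a \<oplus> b \<equiv> add M a b"
abbreviation times (infixl "\<otimes>" 70) where "a \<otimes> b \<equiv> mul M a b"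

lemma axioms:
  "S a \<noteq> Z" "S a = S b \<longleftrightarrow> a = b" "a \<oplus> Z = a" "a \<oplus> S b = S (a \<oplus> b)"
  "a \<otimes> Z = Z" "a \<otimes> S b = a \<otimes> b \<oplus> a"
proof -
  have "sat M e A" if "A \<in> set basic_axioms" for A e
    using that by (intro sat_PA PA.basic)
  then have ax: "\<forall>A\<in>set basic_axioms. sat M (\<lambda>_. Z) A" by blast
  show "S a \<noteq> Z" "S a = S b \<longleftrightarrow> a = b" "a \<oplus> Z = a" "a \<oplus> S b = S (a \<oplus> b)"
    "a \<otimes> Z = Z" "a \<otimes> S b = a \<otimes> b \<oplus> a"
    using ax by (auto simp: basic_axioms_def)
qed

declare axioms [simp]

lemma Z_neq_S [simp]: "Z \<noteq> S a"
  using axioms(1) by metis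

text \<open>Elements may be nonstandard, so induction is available only for properties defined by a
  formula. Each law below is therefore first written as a formula, with its parameters placed in the
  environment.\<close>

lemma sat_induct:
  assumes "sat M (case_nat Z e) A"
    and "\<And>a. sat M (case_nat a e) A \<Longrightarrow> sat M (case_nat (S a) e) A"
  shows "sat M (case_nat a e) A"
  using sat_PA[OF PA.induction[of A], of e] assms
  unfolding sat.simps sat_subst0[where w = Zero] sat_induction_step eval.simps by blast

lemma Z_plus [simp]: "Z \<oplus> a = a"
proof -
  have "sat M (case_nat a (\<lambda>_. Z)) (Zero \<^bold>+ Var 0 \<^bold>= Var 0)" by (rule sat_induct) simp_all
  then show ?thesis by simp
qed

lemma S_plus [simp]: "S b \<oplus> a = S (b \<oplus> a)"
proof -
  have "sat M (case_nat a (\<lambda>_. b)) (Succ (Var 1) \<^bold>+ Var 0 \<^bold>= Succ (Var 1 \<^bold>+ Var 0))"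
    by (rule sat_induct) simp_all
  then show ?thesis by simp
qed

sublocale plus: comm_monoid "add M" Z
proof
  show "a \<oplus> b \<oplus> c = a \<oplus> (b \<oplus> c)" for a b c
  proof -
    have "sat M (case_nat c (case_nat b (\<lambda>_. a)))
      (Var 2 \<^bold>+ Var 1 \<^bold>+ Var 0 \<^bold>= Var 2 \<^bold>+ (Var 1 \<^bold>+ Var 0))"
      by (rule sat_induct) simp_all
    then show ?thesis by simp
  qed
  show "a \<oplus> b = b \<oplus> a" for a b
  proof -
    have "sat M (case_nat b (\<lambda>_. a)) (Var 1 \<^bold>+ Var 0 \<^bold>= Var 0 \<^bold>+ Var 1)"
      by (rule sat_induct) simp_all
    then show ?thesis by simp
  qed
qed simp

lemmas plus_ac = plus.assoc plus.commute plus.left_commute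

lemma plus_right_cancel [simp]: "a \<oplus> c = b \<oplus> c \<longleftrightarrow> a = b"
proof -
  have "sat M (case_nat c (case_nat b (\<lambda>_. a)))
    (Var 2 \<^bold>+ Var 0 \<^bold>= Var 1 \<^bold>+ Var 0 \<^bold>\<longrightarrow> Var 2 \<^bold>= Var 1)"
    by (rule sat_induct) simp_all
  then show ?thesis by auto
qed

lemma plus_left_cancel [simp]: "c \<oplus> a = c \<oplus> b \<longleftrightarrow> a = b"
  using plus_right_cancel by (simp add: plus.commute)

lemma Z_times [simp]: "Z \<otimes> a = Z"
proof -
  have "sat M (case_nat a (\<lambda>_. Z)) (Zero \<^bold>* Var 0 \<^bold>= Zero)" by (rule sat_induct) simp_all
  then show ?thesis by simp
qed

lemma S_times [simp]: "S b \<otimes> a = b \<otimes> a \<oplus> a"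
proof -
  have "sat M (case_nat a (\<lambda>_. b)) (Succ (Var 1) \<^bold>* Var 0 \<^bold>= Var 1 \<^bold>* Var 0 \<^bold>+ Var 0)"
    by (rule sat_induct) (simp_all add: plus_ac)
  then show ?thesis by simp
qed

lemma plus_times: "(a \<oplus> b) \<otimes> c = a \<otimes> c \<oplus> b \<otimes> c"
proof -
  have "sat M (case_nat c (case_nat b (\<lambda>_. a)))
    ((Var 2 \<^bold>+ Var 1) \<^bold>* Var 0 \<^bold>= Var 2 \<^bold>* Var 0 \<^bold>+ Var 1 \<^bold>* Var 0)"
    by (rule sat_induct) (simp_all add: plus_ac)
  then show ?thesis by simp
qed

lemma times_plus: "c \<otimes> (a \<oplus> b) = c \<otimes> a \<oplus> c \<otimes> b"
proof -
  have "sat M (case_nat b (case_nat a (\<lambda>_. c)))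
    (Var 2 \<^bold>* (Var 1 \<^bold>+ Var 0) \<^bold>= Var 2 \<^bold>* Var 1 \<^bold>+ Var 2 \<^bold>* Var 0)"
    by (rule sat_induct) (simp_all add: plus_ac)
  then show ?thesis by simp
qed

lemma Z_or_S: "a = Z \<or> (\<exists>b. a = S b)"
proof -
  have "sat M (case_nat a (\<lambda>_. Z)) (Var 0 \<^bold>= Zero \<^bold>\<or> \<^bold>\<exists>(Var 1 \<^bold>= Succ (Var 0)))"
    by (rule sat_induct) simp_all
  then show ?thesis by simp
qed

lemma trichotomy:
  obtains "a = b" | d where "b = S (a \<oplus> d)" | d where "a = S (b \<oplus> d)"
proof -
  have "sat M (case_nat a (\<lambda>_. b)) (Var 0 \<^bold>= Var 1 \<^bold>\<or> \<^bold>\<exists>(Var 2 \<^bold>= Succ (Var 1 \<^bold>+ Var 0)) \<^bold>\<or>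
    \<^bold>\<exists>(Var 1 \<^bold>= Succ (Var 2 \<^bold>+ Var 0)))" (is "sat M (case_nat a ?e) ?A")
  proof (rule sat_induct)
    show "sat M (case_nat Z ?e) ?A" using Z_or_S[of b] by (auto simp: eval_nat_numeral)
    fix a
    assume "sat M (case_nat a ?e) ?A"
    then consider "a = b" | d where "b = S (a \<oplus> d)" | d where "a = S (b \<oplus> d)"
      by (auto simp: eval_nat_numeral)
    then have "S a = b \<or> (\<exists>d. b = S (S a \<oplus> d)) \<or> (\<exists>d. S a = S (b \<oplus> d))"
    proof cases
      case 1
      then show ?thesis by (metis axioms(3))
    next
      case 2
      \<comment> \<open>If d is \<open>Z\<close>, then b is \<open>S a\<close>; otherwise one
        successor moves from d to a.\<close>
      then show ?thesis using Z_or_S[of d] by (metis axioms(3,4) S_plus)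
    next
      case 3
      then show ?thesis by (metis axioms(4))
    qed
    then show "sat M (case_nat (S a) ?e) ?A" by (auto simp: eval_nat_numeral)
  qed
  then show thesis using that by (auto simp: eval_nat_numeral)
qed

section \<open>Order, pairing and truncation in a model\<close>

lemma leI: "b = d \<oplus> a \<Longrightarrow> le M a b"
  by (auto simp: le_def)

lemma le_trans: "le M a b \<Longrightarrow> le M b c \<Longrightarrow> le M a c"
  unfolding le_def by (metis plus.assoc)

lemma le_S: "le M a b \<Longrightarrow> le M a (S b)"
  unfolding le_def by (metis S_plus)

text \<open>The counterpart of \<open>square_add_less\<close> without subtraction: the larger value
  is the smaller one plus an explicit successor.\<close>

lemma pr_neq:
  assumes "u \<oplus> v = S (x \<oplus> y \<oplus> d)"
  shows "pr M x y \<noteq> pr M u v"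
proof
  assume eq: "pr M x y = pr M u v"
  let ?w = "x \<oplus> y"
  let ?r = "?w \<otimes> d \<oplus> (d \<otimes> ?w \<oplus> d \<otimes> d)"
  \<comment> \<open>Expand the square of w + d + 1, add u, and split off the square of w together
    with one x taken from w = x + y.\<close>
  have "pr M u v = (?w \<otimes> ?w \<oplus> x) \<oplus> S (?r \<oplus> y \<oplus> d \<oplus> x \<oplus> y \<oplus> d \<oplus> u)"
    unfolding pr_def assms by (simp add: plus_times times_plus plus_ac)
  then have "(?w \<otimes> ?w \<oplus> x) \<oplus> Z = (?w \<otimes> ?w \<oplus> x) \<oplus> S (?r \<oplus> y \<oplus> d \<oplus> x \<oplus> y \<oplus> d \<oplus> u)"
    using eq unfolding pr_def by simp
  then show False unfolding plus_left_cancel by simp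
qed

lemma pr_eq_iff [simp]: "pr M x y = pr M u v \<longleftrightarrow> x = u \<and> y = v"
proof
  assume eq: "pr M x y = pr M u v"
  have "x \<oplus> y = u \<oplus> v"
    by (rule trichotomy[of "x \<oplus> y" "u \<oplus> v"]) (use eq pr_neq in metis)+
  with eq show "x = u \<and> y = v" unfolding pr_def by auto
qed simp

lemma le_pr: "le M x (pr M x y)" "le M y (pr M x y)"
proof -
  show "le M x (pr M x y)" unfolding pr_def by (rule leI) (rule refl)
  \<comment> \<open>For w = \<open>S b\<close> the recursion for multiplication gives d as w times
    b.\<close>
  have "\<exists>d. w \<otimes> w = d \<oplus> w" for w
    using Z_or_S[of w] by (metis axioms(3,5,6))
  then obtain d where d: "(x \<oplus> y) \<otimes> (x \<oplus> y) = d \<oplus> (x \<oplus> y)" by blast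
  show "le M y (pr M x y)" unfolding pr_def d
    by (rule leI[of _ "d \<oplus> x \<oplus> x"]) (simp add: plus_ac)
qed

lemma code_iff: "code M z l a b \<longleftrightarrow> z = pr M l (pr M a b)"
  unfolding code_def using le_pr le_trans by metis

lemma len_pr: "len M (pr M l (pr M a b)) n \<longleftrightarrow> n = l"
  unfolding len_def using code_iff[of "pr M l (pr M a b)" l a b] by (auto simp: code_def)

lemma dec_pr:
  "dec M (pr M l (pr M a b)) k y \<longleftrightarrow> le M (S Z) k \<and> le M k l \<and> beta M a b k y"
  unfolding dec_def code_iff by auto

lemma le_pr_S: "le M (pr M l p) (pr M (S l) p)"
  \<comment> \<open>With w = l + p, the square of w + 1 plus l + 1 exceeds the square of w plus l by
    2w + 2, the witness given here.\<close>
  unfolding pr_def by (rule leI[of _ "S (l \<oplus> p \<oplus> S (l \<oplus> p))"]) (simp add: plus_ac)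

text \<open>Keeping \<open>a\<close> and \<open>b\<close> and decrementing the length deletes the last term.\<close>

lemma het_seq_truncate:
  assumes "het_seq M z" "len M z (S n)"
  obtains z' where "het_seq M z'" "len M z' n" "le M z' z" "\<And>t. ele M t z' \<Longrightarrow> ele M t z"
proof -
  obtain a b where z: "z = pr M (S n) (pr M a b)"
    using assms(2) by (auto simp: len_def)
  define z' where "z' = pr M n (pr M a b)"
  \<comment> \<open>The length enters \<open>dec\<close> only as an upper bound for k, so terms keep
    their positions. A repetition in \<open>z'\<close> would thus be one in
    \<open>z\<close>.\<close>
  have dec: "dec M z k y" if "dec M z' k y" for k y
    using that le_S unfolding z z'_def dec_pr by blast
  have le: "le M z' z" unfolding z z'_def by (rule le_pr_S)
  have code: "\<exists>l a b. code M z' l a b" "\<exists>l a b. code M z l a b"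
    unfolding z z'_def code_iff by blast+
  have bound: "le M n z'" "le M (S n) z" unfolding z z'_def by (rule le_pr)+
  have len: "len M z' l \<longleftrightarrow> l = n" "len M z l \<longleftrightarrow> l = S n" for l
    unfolding z z'_def len_pr by auto
  show thesis
  proof
    show "het_seq M z'"
      using assms(1) code bound le le_trans le_S dec unfolding het_seq_def len by meson
    show "len M z' n" by (simp add: len)
    show "le M z' z" by (rule le)
    show "ele M t z" if "ele M t z'" for t
      using that code bound le_S dec unfolding ele_def len by meson
  qed
qed

end

section \<open>Undecidability of all instances\<close>

lemma fv_Prov_neg_dot_fm: "fv (Prov_neg_dot_fm A x t) \<subseteq> fv_tm t"
  by (auto simp: Prov_neg_dot_fm_def)

text \<open>In every model of PA, truncation turns a witness for n + 1 into a witness for n: the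
  remaining terms still have the property \<open>P\<close>, whatever nonstandard proofs it may rest
  on.\<close>

lemma PA_refutable_Suc:
  assumes R: "fv R = {x}"
    and diag: "\<turnstile> R \<^bold>\<longleftrightarrow>
           \<^bold>\<exists>(HetSeq_fm (Var 0) \<^bold>\<and> Len_fm (Var 0) (Succ (Var (Suc x))) \<^bold>\<and>
              (\<^bold>\<forall>\<^bold>\<le>Var 0. (Ele_fm (Var 0) (Var 1) \<^bold>\<longrightarrow> Prov_neg_dot_fm R x (Var 0))))"
    and ref: "\<turnstile> \<^bold>\<not> subst x (num n) R"
  shows "\<turnstile> \<^bold>\<not> subst x (num (Suc n)) R"
proof (rule PA_completeness)
  fix M :: "nat interp" and e
  assume "\<And>B e. \<turnstile> B \<Longrightarrow> sat M e B"
  then interpret PA_model M by unfold_locales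
  define P where "P t \<longleftrightarrow> sat M (\<lambda>_. t) (Prov_neg_dot_fm R x (Var 0))" for t
  have P: "sat M (case_nat t e') (Prov_neg_dot_fm R x (Var 0)) \<longleftrightarrow> P t" for t e'
    unfolding P_def by (rule sat_cong) (use fv_Prov_neg_dot_fm[of R x "Var 0"] in auto)
  \<comment> \<open>Substituting the numeral amounts to giving x its value in the environment; under
    the outer quantifier of the fixed point, x is \<open>Var (Suc x)\<close>.\<close>
  have R_iff: "sat M e (subst x (num k) R) \<longleftrightarrow>
    (\<exists>z. het_seq M z \<and> len M z (S (eval M e (num k))) \<and> (\<forall>t. le M t z \<longrightarrow> ele M t z \<longrightarrow> P t))" for k
    using sat_PA[OF diag, of "e(x := eval M e (num k))"] sat_subst_only[of R x M e "num k" e] R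
    by (simp add: P)
  have "\<not> sat M e (subst x (num (Suc n)) R)"
  proof
    assume "sat M e (subst x (num (Suc n)) R)"
    then obtain z where z: "het_seq M z" "len M z (S (S (eval M e (num n))))"
      "\<And>t. le M t z \<Longrightarrow> ele M t z \<Longrightarrow> P t"
      unfolding R_iff by auto
    obtain z' where "het_seq M z'" "len M z' (S (eval M e (num n)))" "le M z' z"
      "\<And>t. ele M t z' \<Longrightarrow> ele M t z"
      using het_seq_truncate[OF z(1,2)] by blast
    with z(3) le_trans have "sat M e (subst x (num n) R)" unfolding R_iff by blast
    with sat_PA[OF ref, of e] show False by simp
  qed
  then show "sat M e (\<^bold>\<not> subst x (num (Suc n)) R)" by simp
qed

lemma ex_codes_het_seq: "het_seq NN z \<Longrightarrow> \<exists>xs. codes z xs"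
  by (simp add: het_seq_def code_codes)

theorem theorem11:
  fixes R :: fm and x :: nat
  assumes "PA_consistent"
    and "PA_omega_consistent"
    and "fv R = {x}"
    and "\<turnstile> R \<^bold>\<longleftrightarrow>
           \<^bold>\<exists>(HetSeq_fm (Var 0) \<^bold>\<and> Len_fm (Var 0) (Succ (Var (Suc x))) \<^bold>\<and>
              (\<^bold>\<forall>\<^bold>\<le>Var 0. (Ele_fm (Var 0) (Var 1) \<^bold>\<longrightarrow> Prov_neg_dot_fm R x (Var 0))))"
  shows "\<forall>n. undecidable (subst x (num n) R)"
proof -
  define P where "P = {t. \<turnstile> \<^bold>\<not> subst x (num t) R}"
  let ?e = "\<lambda>_. 0 :: nat"
  have R_iff: "sat NN ?e (subst x (num n) R) \<longleftrightarrow>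
    (\<exists>xs. distinct xs \<and> length xs = Suc n \<and> set xs \<subseteq> P)" for n
  proof -
    have "sat NN ?e (subst x (num n) R) \<longleftrightarrow>
      (\<exists>z. het_seq NN z \<and> len NN z (Suc n) \<and> (\<forall>t\<le>z. ele NN t z \<longrightarrow> t \<in> P))"
      using PA_sound[OF assms(4), of "?e(x := n)"] sat_subst_only[of R x NN ?e "num n" ?e] assms(3)
      by (simp add: P_def)
    also have "\<dots> \<longleftrightarrow> (\<exists>z xs. codes z xs \<and> het_seq NN z \<and> len NN z (Suc n) \<and>
      (\<forall>t\<le>z. ele NN t z \<longrightarrow> t \<in> P))"
      using ex_codes_het_seq by blast
    also have "\<dots> \<longleftrightarrow> (\<exists>z xs. codes z xs \<and> distinct xs \<and> length xs = Suc n \<and> set xs \<subseteq> P)"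
    proof (intro ex_cong1 conj_cong refl)
      fix z xs
      assume xs: "codes z xs"
      show "het_seq NN z = distinct xs" using xs by (rule het_seq_codes)
      show "len NN z (Suc n) \<longleftrightarrow> length xs = Suc n" 
        unfolding len_codes[OF xs] by (rule eq_commute)
      show "(\<forall>t\<le>z. ele NN t z \<longrightarrow> t \<in> P) \<longleftrightarrow> set xs \<subseteq> P"
        unfolding ele_codes[OF xs] using codes_le[OF xs] by blast
    qed
    also have "\<dots> \<longleftrightarrow> (\<exists>xs. distinct xs \<and> length xs = Suc n \<and> set xs \<subseteq> P)"
      using ex_codes by blast
    finally show ?thesis .
  qed
  have irrefutable: "t \<notin> P" for t
  proof
    assume t: "t \<in> P"
    have "t + i \<in> P" for i
      by (induction i) (use t PA_refutable_Suc[OF assms(3,4)] in \<open>auto simp: P_def\<close>)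
    \<comment> \<open>Upward closure makes any interval from t onwards available; R(t) needs exactly
      \<open>Suc t\<close> distinct members.\<close>
    then have "distinct [t..<t + Suc t] \<and> length [t..<t + Suc t] = Suc t \<and> set [t..<t + Suc t] \<subseteq> P"
      by (auto simp: le_iff_add)
    then have "sat NN ?e (subst x (num t) R)" unfolding R_iff by blast
    then show False using t PA_sound[of "\<^bold>\<not> subst x (num t) R" ?e] by (simp add: P_def)
  qed
  show ?thesis
  proof
    fix n
    have "\<not> (\<turnstile> subst x (num n) R)"
    proof
      assume "\<turnstile> subst x (num n) R"
      \<comment> \<open>The length is positive even for n = 0, so a true instance would exhibit a
        member of the empty set \<open>P\<close>.\<close>
      then obtain xs where "length xs = Suc n" "set xs \<subseteq> P"
        using PA_sound R_iff by blast
      then show False using irrefutable by (cases xs) auto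
    qed
    moreover have "\<not> (\<turnstile> \<^bold>\<not> subst x (num n) R)" using irrefutable[of n] by (simp add: P_def)
    ultimately show "undecidable (subst x (num n) R)" by (simp add: undecidable_def)
  qed
qed

end
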